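(* Let $k\ge 1$ be an integer. As an $L(k,0)^{\mathbb{Z}_3}$-module, $$L(k,0)=L(k,0)^0\oplus L(k,0)^1\oplus L(k,0)^2,$$ where $L(k,0)^0\ (=L(k,0)^{\mathbb{Z}_3})$ is a simple vertex operator algebra, and $L(k,0)^0$ (resp. $L(k,0)^1$, $L(k,0)^2$) is the irreducible $L(k,0)^{\mathbb{Z}_3}$-module generated by the lowest weight vector $\mathbf{1}$ (resp. $e(-1)\mathbf{1}$, $f(-1)\mathbf{1}$) with the lowest weight $0$ (resp. $1$, $1$).
   Context: $\{h,e,f\}$ is a standard Chevalley basis of $\mathfrak{sl}_2(\mathbb{C})$ with $[h,e]=2e$, $[h,f]=-2f$, $[e,f]=h$. $L(k,0)=L_{\widehat{\mathfrak{sl}_2}}(k,0)$ is the simple affine vertex operator algebra of level $k$ with vacuum $\mathbf{1}$; $a\in\mathfrak{sl}_2$ is identified with $a(-1)\mathbf{1}$ and $Y(a(-1)\mathbf{1},z)=\sum_{n\in\mathbb{Z}}a(n)z^{-n-1}$. The automorphism $\sigma$ of $\mathfrak{sl}_2(\mathbb{C})$ is defined by $\sigma(h)=h$, $\sigma(e)=\frac{-1+\sqrt{-3}}{2}e$, $\sigma(f)=\frac{-1-\sqrt{-3}}{2}f$; it lifts to an automorphism $\sigma$ of $L(k,0)$ generating a cyclic group $\mathbb{Z}_3=\{1,\sigma,\sigma^2\}$. $L(k,0)^{\mathbb{Z}_3}$ is the fixed point vertex operator subalgebra. Weights are $L(0)$-eigenvalues; the lowest weight of an irreducible module is the smallest $L(0)$-eigenvalue,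 and a lowest weight vector is a nonzero vector of that weight. *)

theory Defs
  imports "HOL-Analysis.Determinants" "HOL-Library.Groups_Big_Fun" "HOL-Library.Nonpos_Ints" "HOL.Hull"
begin

section \<open>Linear algebra over explicit carriers\<close>

text \<open>
  Spaces are carried by subspaces of an ambient complex vector space
  \<open>(\<^typ>\<open>'v\<close>, smul)\<close>, so that subalgebras and submodules are again carriers.
  Operators are total functions; only their values on the carriers matter.
\<close>

definition linear_on_carrier ::
  "(complex \<Rightarrow> 'a::ab_group_add \<Rightarrow> 'a) \<Rightarrow> 'a set \<Rightarrow> (complex \<Rightarrow> 'b::ab_group_add \<Rightarrow> 'b) \<Rightarrow>
   ('a \<Rightarrow> 'b) \<Rightarrow> bool" where
  "linear_on_carrier s A t f \<longleftrightarrow>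
     (\<forall>x\<in>A. \<forall>y\<in>A. f (x + y) = f x + f y) \<and> (\<forall>c. \<forall>x\<in>A. f (s c x) = t c (f x))"

definition internal_direct_sum ::
  "(complex \<Rightarrow> 'a::ab_group_add \<Rightarrow> 'a) \<Rightarrow> 'i set \<Rightarrow> ('i \<Rightarrow> 'a set) \<Rightarrow> 'a set \<Rightarrow> bool" where
  "internal_direct_sum s I W A \<longleftrightarrow>
     module.subspace s A \<and>
     (\<forall>i\<in>I. module.subspace s (W i) \<and> W i \<subseteq> A) \<and>
     (\<forall>x\<in>A. \<exists>!g. (\<forall>i\<in>I. g i \<in> W i) \<and> (\<forall>i. i \<notin> I \<longrightarrow> g i = 0) \<and>
                 finite {i. g i \<noteq> 0} \<and> x = Sum_any g)"

definition eigenspace_on ::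
  "(complex \<Rightarrow> 'a::ab_group_add \<Rightarrow> 'a) \<Rightarrow> 'a set \<Rightarrow> ('a \<Rightarrow> 'a) \<Rightarrow> complex \<Rightarrow> 'a set" where
  "eigenspace_on s A T c = {x \<in> A. T x = s c x}"

definition finite_dim ::
  "(complex \<Rightarrow> 'a::ab_group_add \<Rightarrow> 'a) \<Rightarrow> 'a set \<Rightarrow> bool" where
  "finite_dim s A \<longleftrightarrow> (\<exists>B. finite B \<and> A \<subseteq> module.span s B)"


section \<open>Vertex operator algebras and their modules\<close>

text \<open>
  \<open>Y u n w\<close> is the mode \<open>u\<^sub>n w\<close>, where \<open>Y(u,z) = \<Sum> u\<^sub>n z\<^sup>-\<^sup>n\<^sup>-\<^sup>1\<close>.
\<close>

definition vertex_operator_map ::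
  "(complex \<Rightarrow> 'v::ab_group_add \<Rightarrow> 'v) \<Rightarrow> 'v set \<Rightarrow>
   (complex \<Rightarrow> 'w::ab_group_add \<Rightarrow> 'w) \<Rightarrow> 'w set \<Rightarrow> ('v \<Rightarrow> int \<Rightarrow> 'w \<Rightarrow> 'w) \<Rightarrow> bool" where
  "vertex_operator_map s V t W Y \<longleftrightarrow>
     (\<forall>u\<in>V. \<forall>n. \<forall>w\<in>W. Y u n w \<in> W) \<and>
     (\<forall>n. \<forall>w\<in>W. linear_on_carrier s V t (\<lambda>u. Y u n w)) \<and>
     (\<forall>u\<in>V. \<forall>n. linear_on_carrier t W t (Y u n)) \<and>
     (\<forall>u\<in>V. \<forall>w\<in>W. \<exists>N. \<forall>n\<ge>N. Y u n w = 0)"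

text \<open>
  The Jacobi identity
  \[ z_0^{-1}\delta(\tfrac{z_1-z_2}{z_0}) Y_W(u,z_1) Y_W(v,z_2)
     - z_0^{-1}\delta(\tfrac{z_2-z_1}{-z_0}) Y_W(v,z_2) Y_W(u,z_1)
     = z_2^{-1}\delta(\tfrac{z_1-z_0}{z_2}) Y_W(Y(u,z_0)v,z_2) \]
  is stated through the coefficients of \<open>z\<^sub>0\<^sup>-\<^sup>l\<^sup>-\<^sup>1 z\<^sub>1\<^sup>-\<^sup>m\<^sup>-\<^sup>1 z\<^sub>2\<^sup>-\<^sup>n\<^sup>-\<^sup>1\<close>.
  By truncation, both sums have only finitely many nonzero terms, so that \<^const>\<open>Sum_any\<close>
  (which is 0 on infinite support) is the intended sum.
\<close>

definition jacobi_identity ::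
  "'v set \<Rightarrow> ('v \<Rightarrow> int \<Rightarrow> 'v \<Rightarrow> 'v) \<Rightarrow>
   (complex \<Rightarrow> 'w::ab_group_add \<Rightarrow> 'w) \<Rightarrow> 'w set \<Rightarrow> ('v \<Rightarrow> int \<Rightarrow> 'w \<Rightarrow> 'w) \<Rightarrow> bool" where
  "jacobi_identity V Y t W YW \<longleftrightarrow>
     (\<forall>u\<in>V. \<forall>v\<in>V. \<forall>w\<in>W. \<forall>l m n :: int.
        Sum_any (\<lambda>i::nat.
          t ((-1) ^ i * (of_int l gchoose i))
            (YW u (m + l - int i) (YW v (n + int i) w)
             - t ((-1) powi l) (YW v (n + l - int i) (YW u (m + int i) w))))
        = Sum_any (\<lambda>i::nat.
          t (of_int m gchoose i) (YW (Y u (l + int i) v) (m + n - int i) w)))"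

text \<open>\<open>Y(\<omega>,z) = \<Sum> L(n) z\<^sup>-\<^sup>n\<^sup>-\<^sup>2\<close>, that is \<open>L(n) = \<omega>\<^bsub>n+1\<^esub>\<close>.\<close>

definition vir_mode :: "('v \<Rightarrow> int \<Rightarrow> 'w \<Rightarrow> 'w) \<Rightarrow> 'v \<Rightarrow> int \<Rightarrow> 'w \<Rightarrow> 'w" where
  "vir_mode Y omega n = Y omega (n + 1)"

definition weight_space ::
  "(complex \<Rightarrow> 'w::ab_group_add \<Rightarrow> 'w) \<Rightarrow> 'w set \<Rightarrow> ('v \<Rightarrow> int \<Rightarrow> 'w \<Rightarrow> 'w) \<Rightarrow> 'v \<Rightarrow>
   complex \<Rightarrow> 'w set" where
  "weight_space t W Y omega c = eigenspace_on t W (vir_mode Y omega 0) c"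

locale voa = vector_space smul
  for smul :: "complex \<Rightarrow> 'v::ab_group_add \<Rightarrow> 'v" +
  fixes V :: "'v set"
    and Y :: "'v \<Rightarrow> int \<Rightarrow> 'v \<Rightarrow> 'v"
    and vac omega :: 'v
  assumes subspace_V: "subspace V"
    and vac_in: "vac \<in> V"
    and omega_in: "omega \<in> V"
    and vertex_operators: "vertex_operator_map smul V smul V Y"
    and vacuum: "\<And>v n. v \<in> V \<Longrightarrow> Y vac n v = (if n = -1 then v else 0)"
    and creation_nonneg: "\<And>u n. u \<in> V \<Longrightarrow> n \<ge> 0 \<Longrightarrow> Y u n vac = 0"
    and creation: "\<And>u. u \<in> V \<Longrightarrow> Y u (-1) vac = u"
    and jacobi: "jacobi_identity V Y smul V Y"
    and virasoro: "\<exists>c. \<forall>m n. \<forall>v\<in>V.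
          vir_mode Y omega m (vir_mode Y omega n v) - vir_mode Y omega n (vir_mode Y omega m v)
          = smul (of_int (m - n)) (vir_mode Y omega (m + n) v)
            + smul (if m + n = 0 then of_int (m ^ 3 - m) / 12 * c else 0) v"
    and derivative: "\<And>u v n. u \<in> V \<Longrightarrow> v \<in> V \<Longrightarrow>
          Y (vir_mode Y omega (-1) u) n v = smul (- of_int n) (Y u (n - 1) v)"
    and grading: "internal_direct_sum smul (UNIV :: int set)
          (\<lambda>n. weight_space smul V Y omega (of_int n)) V"
    and weight_finite_dim: "\<And>n::int. finite_dim smul (weight_space smul V Y omega (of_int n))"
    and weight_bounded_below: "\<exists>N. \<forall>n<N. weight_space smul V Y omega (of_int n) = {0}"

definition voa_ideal ::
  "(complex \<Rightarrow> 'v::ab_group_add \<Rightarrow> 'v) \<Rightarrow> 'v set \<Rightarrow> ('v \<Rightarrow> int \<Rightarrow> 'v \<Rightarrow> 'v) \<Rightarrow> 'v set \<Rightarrow> bool" where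
  "voa_ideal smul V Y I \<longleftrightarrow> module.subspace smul I \<and> I \<subseteq> V \<and>
     (\<forall>v\<in>V. \<forall>n. \<forall>w\<in>I. Y v n w \<in> I \<and> Y w n v \<in> I)"

definition simple_voa ::
  "(complex \<Rightarrow> 'v::ab_group_add \<Rightarrow> 'v) \<Rightarrow> 'v set \<Rightarrow> ('v \<Rightarrow> int \<Rightarrow> 'v \<Rightarrow> 'v) \<Rightarrow> 'v \<Rightarrow> 'v \<Rightarrow> bool" where
  "simple_voa smul V Y vac omega \<longleftrightarrow> voa smul V Y vac omega \<and> V \<noteq> {0} \<and>
     (\<forall>I. voa_ideal smul V Y I \<longrightarrow> I = {0} \<or> I = V)"

definition voa_automorphism ::
  "(complex \<Rightarrow> 'v::ab_group_add \<Rightarrow> 'v) \<Rightarrow> 'v set \<Rightarrow> ('v \<Rightarrow> int \<Rightarrow> 'v \<Rightarrow> 'v) \<Rightarrow> 'v \<Rightarrow> 'v \<Rightarrow>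
   ('v \<Rightarrow> 'v) \<Rightarrow> bool" where
  "voa_automorphism smul V Y vac omega g \<longleftrightarrow>
     linear_on_carrier smul V smul g \<and> bij_betw g V V \<and>
     (\<forall>u\<in>V. \<forall>n. \<forall>v\<in>V. g (Y u n v) = Y (g u) n (g v)) \<and> g vac = vac \<and> g omega = omega"

definition fixed_points :: "'v set \<Rightarrow> ('v \<Rightarrow> 'v) set \<Rightarrow> 'v set" where
  "fixed_points V G = {v \<in> V. \<forall>g\<in>G. g v = v}"

text \<open>Ordinary modules: graded by \<open>L(0)\<close>-eigenspaces with arbitrary complex eigenvalues.\<close>

locale voa_module = A: voa smul V Y vac omega + M: vector_space smulW
  for smul :: "complex \<Rightarrow> 'v::ab_group_add \<Rightarrow> 'v"
    and V :: "'v set"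
    and Y :: "'v \<Rightarrow> int \<Rightarrow> 'v \<Rightarrow> 'v"
    and vac omega :: 'v
    and smulW :: "complex \<Rightarrow> 'w::ab_group_add \<Rightarrow> 'w" +
  fixes W :: "'w set"
    and YW :: "'v \<Rightarrow> int \<Rightarrow> 'w \<Rightarrow> 'w"
  assumes subspace_W: "M.subspace W"
    and module_operators: "vertex_operator_map smul V smulW W YW"
    and module_vacuum: "\<And>w n. w \<in> W \<Longrightarrow> YW vac n w = (if n = -1 then w else 0)"
    and module_jacobi: "jacobi_identity V Y smulW W YW"
    and module_grading: "internal_direct_sum smulW (UNIV :: complex set)
          (weight_space smulW W YW omega) W"
    and module_weight_finite_dim: "\<And>c. finite_dim smulW (weight_space smulW W YW omega c)"
    and module_weight_bounded_below:
          "\<And>c. \<exists>N::int. \<forall>n<N. weight_space smulW W YW omega (c + of_int n) = {0}"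

text \<open>
  A subspace stable under all modes is stable under \<open>L(0)\<close>, hence graded, and so is a module.
\<close>

definition voa_submodule ::
  "'v set \<Rightarrow> (complex \<Rightarrow> 'w::ab_group_add \<Rightarrow> 'w) \<Rightarrow> 'w set \<Rightarrow> ('v \<Rightarrow> int \<Rightarrow> 'w \<Rightarrow> 'w) \<Rightarrow> 'w set \<Rightarrow> bool"
  where
  "voa_submodule V t W YW U \<longleftrightarrow> module.subspace t U \<and> U \<subseteq> W \<and>
     (\<forall>v\<in>V. \<forall>n. \<forall>w\<in>U. YW v n w \<in> U)"

definition irreducible_voa_module ::
  "(complex \<Rightarrow> 'v::ab_group_add \<Rightarrow> 'v) \<Rightarrow> 'v set \<Rightarrow> ('v \<Rightarrow> int \<Rightarrow> 'v \<Rightarrow> 'v) \<Rightarrow> 'v \<Rightarrow> 'v \<Rightarrow>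
   (complex \<Rightarrow> 'w::ab_group_add \<Rightarrow> 'w) \<Rightarrow> 'w set \<Rightarrow> ('v \<Rightarrow> int \<Rightarrow> 'w \<Rightarrow> 'w) \<Rightarrow> bool" where
  "irreducible_voa_module smul V Y vac omega t W YW \<longleftrightarrow>
     voa_module smul V Y vac omega t W YW \<and> W \<noteq> {0} \<and>
     (\<forall>U. voa_submodule V t W YW U \<longrightarrow> U = {0} \<or> U = W)"

definition generates_voa_module ::
  "'v set \<Rightarrow> (complex \<Rightarrow> 'w::ab_group_add \<Rightarrow> 'w) \<Rightarrow> 'w set \<Rightarrow> ('v \<Rightarrow> int \<Rightarrow> 'w \<Rightarrow> 'w) \<Rightarrow> 'w \<Rightarrow> bool"
  where
  "generates_voa_module V t W YW w \<longleftrightarrow> w \<in> W \<and> voa_submodule V t W YW hull {w} = W"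

definition is_weight ::
  "(complex \<Rightarrow> 'w::ab_group_add \<Rightarrow> 'w) \<Rightarrow> 'w set \<Rightarrow> ('v \<Rightarrow> int \<Rightarrow> 'w \<Rightarrow> 'w) \<Rightarrow> 'v \<Rightarrow> complex \<Rightarrow> bool"
  where
  "is_weight t W YW omega c \<longleftrightarrow> (\<exists>w. w \<noteq> 0 \<and> w \<in> weight_space t W YW omega c)"

text \<open>Weights are complex; \<open>c \<le> d\<close> for weights means that \<open>d - c\<close> is a nonnegative real.\<close>

definition is_lowest_weight ::
  "(complex \<Rightarrow> 'w::ab_group_add \<Rightarrow> 'w) \<Rightarrow> 'w set \<Rightarrow> ('v \<Rightarrow> int \<Rightarrow> 'w \<Rightarrow> 'w) \<Rightarrow> 'v \<Rightarrow> complex \<Rightarrow> bool"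
  where
  "is_lowest_weight t W YW omega c \<longleftrightarrow> is_weight t W YW omega c \<and>
     (\<forall>d. is_weight t W YW omega d \<longrightarrow> d - c \<in> \<real>\<^sub>\<ge>\<^sub>0)"

definition lowest_weight_vector ::
  "(complex \<Rightarrow> 'w::ab_group_add \<Rightarrow> 'w) \<Rightarrow> 'w set \<Rightarrow> ('v \<Rightarrow> int \<Rightarrow> 'w \<Rightarrow> 'w) \<Rightarrow> 'v \<Rightarrow> complex \<Rightarrow>
   'w \<Rightarrow> bool" where
  "lowest_weight_vector t W YW omega c w \<longleftrightarrow> is_lowest_weight t W YW omega c \<and>
     w \<noteq> 0 \<and> w \<in> weight_space t W YW omega c"


section \<open>The simple affine vertex operator algebra of \<open>sl\<^sub>2\<close>\<close>

definition sl2 :: "(complex^2^2) set" where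
  "sl2 = {A. trace A = 0}"

definition lie_bracket :: "complex^2^2 \<Rightarrow> complex^2^2 \<Rightarrow> complex^2^2" where
  "lie_bracket A B = A ** B - B ** A"

definition sl2_h :: "complex^2^2" where
  "sl2_h = vector [vector [1, 0], vector [0, -1]]"

definition sl2_e :: "complex^2^2" where
  "sl2_e = vector [vector [0, 1], vector [0, 0]]"

definition sl2_f :: "complex^2^2" where
  "sl2_f = vector [vector [0, 0], vector [1, 0]]"

text \<open>
  A module of level \<open>k\<close> for the affine Lie algebra \<open>sl\<^sub>2 \<otimes> \<complex>[t,t\<^sup>-\<^sup>1] \<oplus> \<complex>K\<close>: \<open>act a n\<close> is the
  operator \<open>a(n)\<close> of \<open>a \<otimes> t\<^sup>n\<close>, and \<open>K\<close> acts as \<open>k\<close>. The invariant form is the trace form,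
  which is normalised by \<open>\<langle>h,h\<rangle> = 2\<close>. Scalar multiples of matrices are written \<open>mat c ** a\<close>.
\<close>

locale affine_sl2_module = vector_space smul
  for smul :: "complex \<Rightarrow> 'v::ab_group_add \<Rightarrow> 'v" +
  fixes V :: "'v set"
    and k :: complex
    and act :: "complex^2^2 \<Rightarrow> int \<Rightarrow> 'v \<Rightarrow> 'v"
  assumes carrier_subspace: "subspace V"
    and act_closed: "\<And>a n v. a \<in> sl2 \<Longrightarrow> v \<in> V \<Longrightarrow> act a n v \<in> V"
    and act_linear: "\<And>a n. a \<in> sl2 \<Longrightarrow> linear_on_carrier smul V smul (act a n)"
    and act_linear_left: "\<And>n v. v \<in> V \<Longrightarrow>
          linear_on_carrier (\<lambda>c a. mat c ** a) sl2 smul (\<lambda>a. act a n v)"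
    and act_commutator: "\<And>a b m n v. a \<in> sl2 \<Longrightarrow> b \<in> sl2 \<Longrightarrow> v \<in> V \<Longrightarrow>
          act a m (act b n v) - act b n (act a m v)
          = act (lie_bracket a b) (m + n) v
            + smul (if m + n = 0 then of_int m * trace (a ** b) * k else 0) v"

definition affine_sl2_submodule ::
  "(complex \<Rightarrow> 'v::ab_group_add \<Rightarrow> 'v) \<Rightarrow> 'v set \<Rightarrow> (complex^2^2 \<Rightarrow> int \<Rightarrow> 'v \<Rightarrow> 'v) \<Rightarrow> 'v set \<Rightarrow> bool"
  where
  "affine_sl2_submodule smul V act U \<longleftrightarrow> module.subspace smul U \<and> U \<subseteq> V \<and>
     (\<forall>a\<in>sl2. \<forall>n. \<forall>v\<in>U. act a n v \<in> U)"

text \<open>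
  The irreducible quotient of the level \<open>k\<close> Weyl module induced from the trivial \<open>sl\<^sub>2\<close>-module:
  an irreducible level \<open>k\<close> module generated by a nonzero vector that \<open>sl\<^sub>2 \<otimes> \<complex>[t]\<close> annihilates.
  This determines the module up to a unique isomorphism preserving \<open>vac\<close>.
\<close>

locale irreducible_vacuum_module = affine_sl2_module +
  fixes vac :: 'a
  assumes vacuum_in: "vac \<in> V"
    and vacuum_nonzero: "vac \<noteq> 0"
    and vacuum_annihilated: "\<And>a n. a \<in> sl2 \<Longrightarrow> n \<ge> 0 \<Longrightarrow> act a n vac = 0"
    and vacuum_generates: "affine_sl2_submodule smul V act hull {vac} = V"
    and irreducible: "\<And>U. affine_sl2_submodule smul V act U \<Longrightarrow> U = {0} \<or> U = V"

text \<open>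
  \<open>L(k,0)\<close>: the vertex operator algebra on the above module in which \<open>a(-1)vac\<close> has the vertex
  operator \<open>\<Sum> a(n) z\<^sup>-\<^sup>n\<^sup>-\<^sup>1\<close>, with the Sugawara conformal vector (\<open>2\<close> is the dual Coxeter number,
  and the dual bases for the trace form are \<open>e, f, h\<close> and \<open>f, e, h/2\<close>).
\<close>

locale simple_affine_sl2_voa =
  voa smul V Y vac omega + irreducible_vacuum_module smul V k act vac
  for smul :: "complex \<Rightarrow> 'v::ab_group_add \<Rightarrow> 'v"
    and V :: "'v set"
    and Y :: "'v \<Rightarrow> int \<Rightarrow> 'v \<Rightarrow> 'v"
    and vac omega :: 'v
    and k :: complex
    and act :: "complex^2^2 \<Rightarrow> int \<Rightarrow> 'v \<Rightarrow> 'v" +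
  assumes noncritical: "k \<noteq> -2"
    and vertex_operator_generator: "\<And>a n v. a \<in> sl2 \<Longrightarrow> v \<in> V \<Longrightarrow>
          Y (act a (-1) vac) n v = act a n v"
    and sugawara: "omega = smul (1 / (2 * (k + 2)))
          (act sl2_e (-1) (act sl2_f (-1) vac) + act sl2_f (-1) (act sl2_e (-1) vac)
           + smul (1 / 2) (act sl2_h (-1) (act sl2_h (-1) vac)))"

lemma chevalley_relations:
  "sl2_h \<in> sl2" "sl2_e \<in> sl2" "sl2_f \<in> sl2"
  "lie_bracket sl2_h sl2_e = mat 2 ** sl2_e"
  "lie_bracket sl2_h sl2_f = mat (-2) ** sl2_f"
  "lie_bracket sl2_e sl2_f = sl2_h"
  by (simp_all add: sl2_def lie_bracket_def sl2_h_def sl2_e_def sl2_f_def trace_def sum_2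
        vec_eq_iff forall_2 matrix_matrix_mult_def mat_def)

definition zeta3 :: complex where
  "zeta3 = (-1 + csqrt (-3)) / 2"

end

theory Submission
  imports Defs
begin

text \<open>
  Decompose \<open>V = L(k,0)\<close> into the eigenspaces \<open>E c\<close> of \<open>\<sigma>\<close>. The argument is that of Dong and
  Mason for the isotypic components of a finite group of automorphisms, specialised to a cyclic
  group, where a component is an eigenspace and the projection onto it is an explicit average.

  By associativity, all vectors \<open>v\<^sub>n u\<close> with \<open>v \<in> V\<close> span a submodule of \<open>V\<close> for any \<open>u \<in> V\<close>
  (\<open>modes_span_submodule\<close>). If \<open>u \<noteq> 0\<close> this is all of \<open>V\<close>, because \<open>V\<close> is irreducible over itself. For
  \<open>u \<in> E c\<close>, the projection to \<open>E c\<close> sends \<open>v\<^sub>n u\<close> to \<open>(\<pi> v)\<^sub>n u\<close>, where \<open>\<pi>\<close> is the projection of \<open>V\<close>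
  to the fixed points. So \<open>E c\<close> is spanned by \<open>v\<^sub>n u\<close> with \<open>v\<close> fixed, and every nonzero vector of
  \<open>E c\<close> generates it over the fixed points (\<open>eigenspace_irreducible\<close>). Simplicity of the fixed point
  algebra is the case \<open>c = 1\<close>, since an ideal is in particular a submodule.

  Two facts are special to the affine algebra. An automorphism is determined by its values on the
  currents \<open>a(-1)\<one>\<close>, so \<open>\<sigma>\<close> has order 3 (\<open>automorphism_eq_id\<close>). And the weights are known: the
  Sugawara vector gives \<open>[L(0), a(m)] = - m a(m)\<close> (\<open>act_weight\<close>), while \<open>V\<close> is spanned by
  products of creation operators \<open>a(-n)\<close>, \<open>n > 0\<close>, applied to the vacuum
  (\<open>creation_operators_generate\<close>). So all weights are nonnegative integers and weight 0 occurs only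
  on multiples of the vacuum (\<open>weight_cases\<close>). The vacuum is fixed by \<open>\<sigma>\<close> and hence lies in neither
  of the other two eigenspaces, which therefore start in weight 1; there they contain \<open>e(-1)\<one>\<close>
  and \<open>f(-1)\<one>\<close>, which are nonzero because \<open>f(1)e(-1)\<one> = e(1)f(-1)\<one> = k\<one>\<close>.
\<close>

section \<open>Eigenspace decompositions\<close>

locale complex_vector_space = vector_space scale
  for scale :: "complex \<Rightarrow> 'a::ab_group_add \<Rightarrow> 'a"
begin

lemma subspace_Sum_any:
  assumes "subspace S" "\<And>i. g i \<in> S"
  shows "Sum_any g \<in> S"
  using assms by (auto simp: Sum_any.expand_set intro!: subspace_sum)

lemma linear_on_carrier_zero:
  assumes "subspace W" "linear_on_carrier scale W scale T"
  shows "T 0 = 0"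
proof -
  have "T (scale 0 0) = scale 0 (T 0)"
    using assms subspace_0 unfolding linear_on_carrier_def by blast
  then show ?thesis by simp
qed

lemma linear_on_carrier_sum:
  assumes "subspace W" "linear_on_carrier scale W scale T" "\<And>i. i \<in> F \<Longrightarrow> x i \<in> W"
  shows "T (\<Sum>i\<in>F. x i) = (\<Sum>i\<in>F. T (x i))"
  using assms(3)
proof (induction F rule: infinite_finite_induct)
  case (insert j F)
  have "(\<Sum>i\<in>F. x i) \<in> W" using insert.prems by (intro subspace_sum[OF assms(1)]) auto
  then have "T (x j + (\<Sum>i\<in>F. x i)) = T (x j) + T (\<Sum>i\<in>F. x i)"
    using assms(2) insert.prems unfolding linear_on_carrier_def by auto
  then show ?case using insert by simp
qed (simp_all add: linear_on_carrier_zero[OF assms(1,2)])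

lemma subspace_eigenspace_on:
  assumes "subspace W" "linear_on_carrier scale W scale T"
  shows "subspace (eigenspace_on scale W T c)"
  using assms linear_on_carrier_zero[OF assms] unfolding eigenspace_on_def linear_on_carrier_def subspace_def
  by (auto simp: scale_right_distrib mult.commute)

text \<open>
  Applying \<open>T - ev j\<close> to the sum kills the component at \<open>j\<close> and rescales the others by nonzero
  factors; so induction on the number of components extracts them one after the other. The case
  \<open>U = {0}\<close> is linear independence of eigenvectors, the case of a submodule \<open>U\<close> and \<open>T = L(0)\<close> says
  that submodules are graded.
\<close>

lemma eigencomponents_in_invariant_subspace:
  assumes W: "subspace W" and T: "linear_on_carrier scale W scale T"
    and U: "subspace U" "U \<subseteq> W" "\<And>x. x \<in> U \<Longrightarrow> T x \<in> U"
    and "finite F" "inj_on ev F"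
    and "\<And>i. i \<in> F \<Longrightarrow> x i \<in> eigenspace_on scale W T (ev i)"
    and "(\<Sum>i\<in>F. x i) \<in> U"
  shows "\<forall>i\<in>F. x i \<in> U"
  using assms(6-)
proof (induction F arbitrary: x rule: finite_induct)
  case (insert j F)
  let ?s = "\<Sum>i\<in>insert j F. x i"
  have xW: "x i \<in> W" and Tx: "T (x i) = scale (ev i) (x i)" if "i \<in> insert j F" for i
    using insert.prems(2)[OF that] unfolding eigenspace_on_def by auto
  have "T ?s = (\<Sum>i\<in>insert j F. scale (ev i) (x i))"
    using linear_on_carrier_sum[OF W T, of "insert j F" x] xW Tx by simp
  then have "T ?s - scale (ev j) ?s = (\<Sum>i\<in>insert j F. scale (ev i - ev j) (x i))"
    by (simp add: scale_sum_right sum_subtractf[symmetric] scale_left_diff_distrib del: sum.insert)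
  also have "\<dots> = (\<Sum>i\<in>F. scale (ev i - ev j) (x i))"
    using insert.hyps by simp
  finally have "(\<Sum>i\<in>F. scale (ev i - ev j) (x i)) \<in> U"
    using U insert.prems(3) by (metis subspace_diff subspace_scale)
  moreover have "scale (ev i - ev j) (x i) \<in> eigenspace_on scale W T (ev i)" if "i \<in> F" for i
    using insert.prems(2) that subspace_eigenspace_on[OF W T] by (auto intro!: subspace_scale)
  ultimately have *: "\<forall>i\<in>F. scale (ev i - ev j) (x i) \<in> U"
    using insert.IH[of "\<lambda>i. scale (ev i - ev j) (x i)"] insert.prems(1) by auto
  have F: "x i \<in> U" if "i \<in> F" for i
  proof -
    have "ev i - ev j \<noteq> 0" using insert.hyps(2) insert.prems(1) that by (auto simp: inj_on_def)
    then have "x i = scale (inverse (ev i - ev j)) (scale (ev i - ev j) (x i))" by simp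
    also have "\<dots> \<in> U" by (rule subspace_scale[OF U(1)]) (use * that in blast)
    finally show ?thesis .
  qed
  have "x j = ?s - (\<Sum>i\<in>F. x i)" using insert.hyps by simp
  also have "\<dots> \<in> U" by (rule subspace_diff[OF U(1) insert.prems(3) subspace_sum[OF U(1) F]])
  finally show ?case using F by auto
qed simp

lemma eigenvectors_independent:
  assumes W: "subspace W" and T: "linear_on_carrier scale W scale T"
    and F: "finite F" "inj_on ev F" "\<And>i. i \<in> F \<Longrightarrow> x i \<in> eigenspace_on scale W T (ev i)"
    and "(\<Sum>i\<in>F. x i) = 0" and "i \<in> F"
  shows "x i = 0"
proof -
  have "\<forall>i\<in>F. x i \<in> {0}"
  proof (rule eigencomponents_in_invariant_subspace[OF W T _ _ _ F])
    show "subspace {0}" "{0} \<subseteq> W" using subspace_0[OF W] by auto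
    show "T x \<in> {0}" if "x \<in> {0}" for x using that linear_on_carrier_zero[OF W T] by simp
    show "(\<Sum>i\<in>F. x i) \<in> {0}" using assms by simp
  qed
  then show ?thesis using \<open>i \<in> F\<close> by blast
qed

lemma span_Union_subspaces:
  assumes A: "\<And>i. i \<in> I \<Longrightarrow> subspace (A i)" and x: "x \<in> span (\<Union>i\<in>I. A i)"
  shows "\<exists>g. (\<forall>i\<in>I. g i \<in> A i) \<and> (\<forall>i. i \<notin> I \<longrightarrow> g i = 0) \<and> finite {i. g i \<noteq> 0} \<and> x = Sum_any g"
  using x
proof (induction rule: span_induct_alt)
  case base
  show ?case using A subspace_0 by (intro exI[of _ "\<lambda>_. 0"]) auto
next
  case (step c x y)
  obtain i where i: "i \<in> I" "x \<in> A i" using step by auto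
  obtain g where g: "\<forall>i\<in>I. g i \<in> A i" "\<forall>i. i \<notin> I \<longrightarrow> g i = 0" "finite {i. g i \<noteq> 0}" "y = Sum_any g"
    using step by auto
  let ?d = "\<lambda>j. if j = i then scale c x else 0"
  have fin: "finite {j. ?d j \<noteq> 0}" by (rule finite_subset[of _ "{i}"]) auto
  have "Sum_any (\<lambda>j. ?d j + g j) = scale c x + y"
    using g(4) by (subst Sum_any.distrib[OF fin g(3)]) simp
  moreover have "finite {j. ?d j + g j \<noteq> 0}"
    by (rule finite_subset[OF _ finite_UnI[OF fin g(3)]]) auto
  moreover have "\<forall>j\<in>I. ?d j + g j \<in> A j" using i g A by (auto intro!: subspace_add subspace_scale)
  ultimately show ?case using i g(2) by (intro exI[of _ "\<lambda>j. ?d j + g j"]) auto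
qed

text \<open>
  Uniqueness of the decomposition is automatic for eigenspaces, so that gradings may be handled
  through spanning statements alone.
\<close>

lemma internal_direct_sum_eigenspacesI:
  assumes W: "subspace W" and T: "linear_on_carrier scale W scale T"
    and inj: "inj_on ev I" and span: "W \<subseteq> span (\<Union>i\<in>I. eigenspace_on scale W T (ev i))"
  shows "internal_direct_sum scale I (\<lambda>i. eigenspace_on scale W T (ev i)) W"
  unfolding internal_direct_sum_def
proof (intro conjI ballI)
  note sub = subspace_eigenspace_on[OF W T]
  show "subspace W" by fact
  show "subspace (eigenspace_on scale W T (ev i))" for i by (rule sub)
  show "eigenspace_on scale W T (ev i) \<subseteq> W" for i by (auto simp: eigenspace_on_def)
  fix x assume x: "x \<in> W"
  let ?P = "\<lambda>g. (\<forall>i\<in>I. g i \<in> eigenspace_on scale W T (ev i)) \<and> (\<forall>i. i \<notin> I \<longrightarrow> g i = 0) \<and>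
                 finite {i. g i \<noteq> 0} \<and> x = Sum_any g"
  show "\<exists>!g. ?P g"
  proof (rule ex_ex1I)
    show "\<exists>g. ?P g" by (rule span_Union_subspaces[OF sub subsetD[OF span x]])
    fix g g' assume g: "?P g" and g': "?P g'"
    let ?F = "{i. g i \<noteq> 0} \<union> {i. g' i \<noteq> 0}"
    have F: "finite ?F" "?F \<subseteq> I" using g g' by auto
    have "Sum_any g = sum g ?F" "Sum_any g' = sum g' ?F"
      using F(1) by (auto intro!: Sum_any.expand_superset)
    then have sum0: "(\<Sum>i\<in>?F. g i - g' i) = 0" using g g' by (simp add: sum_subtractf)
    have mem: "g i - g' i \<in> eigenspace_on scale W T (ev i)" if "i \<in> ?F" for i
      using subspace_diff[OF sub] that F(2) g g' by blast
    have "g i = g' i" for i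
    proof (cases "i \<in> ?F")
      case True
      then show ?thesis
        using eigenvectors_independent[OF W T F(1) inj_on_subset[OF inj F(2)] mem sum0] by simp
    qed auto
    then show "g = g'" by auto
  qed
qed

lemma internal_direct_sum_subset_span:
  assumes "internal_direct_sum scale I A W"
  shows "W \<subseteq> span (\<Union>i\<in>I. A i)"
proof
  fix x assume "x \<in> W"
  then obtain g where g: "\<forall>i\<in>I. g i \<in> A i" "\<forall>i. i \<notin> I \<longrightarrow> g i = 0" "x = Sum_any g"
    using assms unfolding internal_direct_sum_def by blast
  have "g i \<in> span (\<Union>i\<in>I. A i)" for i
    using g by (cases "i \<in> I") (auto intro!: span_base simp: span_zero)
  then show "x \<in> span (\<Union>i\<in>I. A i)" using g(3) subspace_Sum_any by auto
qed

lemma invariant_subspace_subset_span_eigenspaces: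
  assumes W: "subspace W" and T: "linear_on_carrier scale W scale T"
    and inj: "inj_on ev I" and span: "W \<subseteq> span (\<Union>i\<in>I. eigenspace_on scale W T (ev i))"
    and U: "subspace U" "U \<subseteq> W" "\<And>x. x \<in> U \<Longrightarrow> T x \<in> U"
  shows "U \<subseteq> span (\<Union>i\<in>I. eigenspace_on scale U T (ev i))"
proof
  fix x assume x: "x \<in> U"
  obtain g where g: "\<forall>i\<in>I. g i \<in> eigenspace_on scale W T (ev i)" "\<forall>i. i \<notin> I \<longrightarrow> g i = 0"
      "finite {i. g i \<noteq> 0}" "x = Sum_any g"
    using span_Union_subspaces[OF subspace_eigenspace_on[OF W T] subsetD[OF span subsetD[OF U(2) x]]]
    by blast
  have F: "{i. g i \<noteq> 0} \<subseteq> I" using g by auto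
  have xs: "x = sum g {i. g i \<noteq> 0}" using g(4) by (simp add: Sum_any.expand_set)
  have "\<forall>i\<in>{i. g i \<noteq> 0}. g i \<in> U"
    using F g x xs inj_on_subset[OF inj F]
    by (intro eigencomponents_in_invariant_subspace[OF W T U, of "{i. g i \<noteq> 0}" ev g]) auto
  then have "g i \<in> eigenspace_on scale U T (ev i)" if "g i \<noteq> 0" for i
    using that g F by (auto simp: eigenspace_on_def)
  then show "x \<in> span (\<Union>i\<in>I. eigenspace_on scale U T (ev i))"
    unfolding xs using F by (intro span_sum span_base) auto
qed

lemma eigenvalue_in_spectrum:
  assumes W: "subspace W" and T: "linear_on_carrier scale W scale T"
    and inj: "inj_on ev I"
    and x: "x \<in> span (\<Union>i\<in>I. eigenspace_on scale W T (ev i))"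
      "x \<in> eigenspace_on scale W T c" "x \<noteq> 0"
  shows "c \<in> ev ` I"
proof (rule ccontr)
  assume c: "c \<notin> ev ` I"
  have *: "x \<in> span (\<Union>d\<in>ev ` I. eigenspace_on scale W T d)" using x by simp
  then obtain g where g: "\<forall>d\<in>ev ` I. g d \<in> eigenspace_on scale W T d" "\<forall>d. d \<notin> ev ` I \<longrightarrow> g d = 0"
      "finite {d. g d \<noteq> 0}" "x = Sum_any g"
    using span_Union_subspaces[OF subspace_eigenspace_on[OF W T] *] by blast
  let ?F = "{d. g d \<noteq> 0}" and ?g = "g(c := - x)"
  have gc: "c \<notin> ?F" using g c by auto
  have "sum ?g (insert c ?F) = - x + sum ?g ?F"
    using gc g(3) by (subst sum.insert) auto
  also have "sum ?g ?F = x" using g(4) gc by (auto simp: Sum_any.expand_set intro!: sum.cong)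
  finally have sum0: "sum ?g (insert c ?F) = 0" by simp
  have mem: "?g d \<in> eigenspace_on scale W T (id d)" if "d \<in> insert c ?F" for d
  proof (cases "d = c")
    case False
    then have "d \<in> ev ` I" using that g(2) by auto
    then show ?thesis using False bspec[OF g(1)] by simp
  qed (use x subspace_neg[OF subspace_eigenspace_on[OF W T]] in simp)
  have "?g c = 0"
    using g(3) by (intro eigenvectors_independent[OF W T _ _ mem sum0]) auto
  then show False using x(3) by auto
qed

end

section \<open>Subalgebras and submodules of vertex operator algebras\<close>

sublocale voa \<subseteq> complex_vector_space smul ..

context voa
begin

lemma Y_closed: "u \<in> V \<Longrightarrow> w \<in> V \<Longrightarrow> Y u n w \<in> V"
  using vertex_operators unfolding vertex_operator_map_def by blast

lemma Y_linear: "u \<in> V \<Longrightarrow> linear_on_carrier smul V smul (Y u n)"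
  using vertex_operators unfolding vertex_operator_map_def by blast

lemma Y_linear_left: "w \<in> V \<Longrightarrow> linear_on_carrier smul V smul (\<lambda>u. Y u n w)"
  using vertex_operators unfolding vertex_operator_map_def by blast

lemma Y_truncation: "u \<in> V \<Longrightarrow> w \<in> V \<Longrightarrow> \<exists>N. \<forall>n\<ge>N. Y u n w = 0"
  using vertex_operators unfolding vertex_operator_map_def by blast

lemma Y_zero: "u \<in> V \<Longrightarrow> Y u n 0 = 0"
  using linear_on_carrier_zero[OF subspace_V Y_linear] .

lemma Y_zero_left: "w \<in> V \<Longrightarrow> Y 0 n w = 0"
  using linear_on_carrier_zero[OF subspace_V Y_linear_left] .

lemma Y_add: "u \<in> V \<Longrightarrow> v \<in> V \<Longrightarrow> w \<in> V \<Longrightarrow> Y u n (v + w) = Y u n v + Y u n w"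
  using Y_linear unfolding linear_on_carrier_def by blast

lemma Y_smul: "u \<in> V \<Longrightarrow> w \<in> V \<Longrightarrow> Y u n (smul c w) = smul c (Y u n w)"
  using Y_linear unfolding linear_on_carrier_def by blast

lemma Y_add_left: "u \<in> V \<Longrightarrow> v \<in> V \<Longrightarrow> w \<in> V \<Longrightarrow> Y (u + v) n w = Y u n w + Y v n w"
  using Y_linear_left unfolding linear_on_carrier_def by blast

lemma Y_smul_left: "u \<in> V \<Longrightarrow> w \<in> V \<Longrightarrow> Y (smul c u) n w = smul c (Y u n w)"
  using Y_linear_left unfolding linear_on_carrier_def by blast

lemma Borcherds_identity:
  assumes "u \<in> V" "v \<in> V" "w \<in> V"
  shows "Sum_any (\<lambda>i::nat. smul ((-1) ^ i * (of_int l gchoose i))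
            (Y u (m + l - int i) (Y v (n + int i) w)
             - smul ((-1) powi l) (Y v (n + l - int i) (Y u (m + int i) w))))
        = Sum_any (\<lambda>i::nat. smul (of_int m gchoose i) (Y (Y u (l + int i) v) (m + n - int i) w))"
  using jacobi assms unfolding jacobi_identity_def by blast

lemma weight_space_eq: "weight_space smul W Y omega c = eigenspace_on smul W (Y omega 1) c"
  by (simp add: weight_space_def eigenspace_on_def vir_mode_def)

lemma V_subset_span_weight_spaces:
  "V \<subseteq> span (\<Union>n\<in>(UNIV::int set). eigenspace_on smul V (Y omega 1) (of_int n))"
  using internal_direct_sum_subset_span[OF grading] unfolding weight_space_eq .

text \<open>
  The case \<open>l = 0\<close> of the Jacobi identity, where \<open>0 gchoose i\<close> leaves only the first summand on the
  left.
\<close>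

lemma commutator_formula:
  assumes "u \<in> V" "v \<in> V" "w \<in> V"
  shows "Y u m (Y v n w) - Y v n (Y u m w)
    = Sum_any (\<lambda>i::nat. smul (of_int m gchoose i) (Y (Y u (int i) v) (m + n - int i) w))"
proof -
  have eq: "smul ((-1) ^ i * (of_int 0 gchoose i))
            (Y u (m + 0 - int i) (Y v (n + int i) w)
             - smul ((-1) powi 0) (Y v (n + 0 - int i) (Y u (m + int i) w)))
        = (if i = 0 then Y u m (Y v n w) - Y v n (Y u m w) else 0)" for i
    by (cases i) (simp_all add: gbinomial_0)
  show ?thesis using Borcherds_identity[OF assms, of 0 m n] by (simp only: eq Sum_any.delta add_0)
qed

text \<open>
  Associativity: \<open>a\<^sub>p v\<^sub>q u\<close> is a combination of vectors \<open>(a\<^sub>i v)\<^sub>j u\<close>. In the Jacobi identity, choosing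
  \<open>m\<close> so large that \<open>a\<^sub>m\<^sub>+\<^sub>i u = 0\<close> for all \<open>i \<ge> 0\<close> removes the terms in which \<open>a\<close> acts first. With
  \<open>l = p - m\<close> and \<open>n = q\<close>, the first of the remaining terms is \<open>a\<^sub>p v\<^sub>q u\<close> and the others have the form
  \<open>a\<^sub>p\<^sub>-\<^sub>i v\<^sub>q\<^sub>+\<^sub>i u\<close> with \<open>i > 0\<close>, covered by downward induction on \<open>q\<close> because \<open>v\<^sub>q u = 0\<close> for large \<open>q\<close>.
\<close>

lemma modes_span_submodule:
  assumes u: "u \<in> V"
  shows "voa_submodule V smul V Y (span {Y v n u | v n. v \<in> V})" (is "voa_submodule _ _ _ _ ?S")
proof -
  have gen: "Y v n u \<in> ?S" if "v \<in> V" for v n using that by (intro span_base) blast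
  have sub: "?S \<subseteq> V" by (rule span_minimal) (use u Y_closed subspace_V in auto)
  have key: "Y a p (Y v q u) \<in> ?S" if a: "a \<in> V" and v: "v \<in> V" for a v p q
  proof -
    obtain N where N: "\<And>n. n \<ge> N \<Longrightarrow> Y v n u = 0" using Y_truncation[OF v u] by auto
    obtain m where m: "\<And>n. n \<ge> m \<Longrightarrow> Y a n u = 0" using Y_truncation[OF a u] by auto
    show ?thesis
    proof (induction "nat (N - q)" arbitrary: p q rule: less_induct)
      case less
      let ?l = "p - m" and ?K = "nat (N - q)"
      let ?t = "\<lambda>i. smul ((-1) ^ i * (of_int ?l gchoose i)) (Y a (p - int i) (Y v (q + int i) u))"
      have t: "smul ((-1) ^ i * (of_int ?l gchoose i))
            (Y a (m + ?l - int i) (Y v (q + int i) u)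
             - smul ((-1) powi ?l) (Y v (q + ?l - int i) (Y a (m + int i) u))) = ?t i" for i
        using m v by (simp add: Y_zero)
      have total: "Sum_any ?t \<in> ?S"
        using Borcherds_identity[OF a v u, of ?l m q] gen Y_closed[OF a v] unfolding t
        by (auto intro!: subspace_Sum_any span_scale)
      have "Sum_any ?t = sum ?t {..?K}"
      proof (rule Sum_any.expand_superset)
        show "{i. ?t i \<noteq> 0} \<subseteq> {..?K}"
        proof (rule subsetI, rule ccontr)
          fix i assume i: "i \<in> {i. ?t i \<noteq> 0}" "i \<notin> {..?K}"
          then have "Y v (q + int i) u = 0" by (intro N) simp
          then show False using i(1) a by (simp add: Y_zero)
        qed
      qed simp
      also have "\<dots> = ?t 0 + sum ?t {1..?K}"
        by (simp add: sum.atMost_shift sum.atLeast1_atMost_eq)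
      finally have split: "?t 0 = Sum_any ?t - sum ?t {1..?K}" by (rule eq_diff_eq[THEN iffD2, OF sym])
      have rest: "sum ?t {1..?K} \<in> ?S"
      proof (intro span_sum span_scale)
        fix i assume "i \<in> {1..?K}"
        then show "Y a (p - int i) (Y v (q + int i) u) \<in> ?S" by (intro less) auto
      qed
      have "?t 0 \<in> ?S" unfolding split by (rule span_diff[OF total rest])
      then show ?case by simp
    qed
  qed
  have "Y a p x \<in> ?S" if a: "a \<in> V" and x: "x \<in> ?S" for a p x
  proof -
    have "subspace {x \<in> V. Y a p x \<in> ?S}"
      using a subspace_V unfolding subspace_def
      by (simp add: Y_zero Y_add Y_smul span_zero span_add span_scale)
    then have "?S \<subseteq> {x \<in> V. Y a p x \<in> ?S}"
      using key[OF a] Y_closed[OF _ u] by (intro span_minimal) auto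
    then show ?thesis using x by blast
  qed
  then show ?thesis using sub unfolding voa_submodule_def by auto
qed

text \<open>
  Containing \<open>\<omega>\<close> makes a subalgebra stable under \<open>L(0)\<close>, hence graded by the same integers.
\<close>

lemma subalgebra_voa:
  assumes U: "subspace U" "U \<subseteq> V" "vac \<in> U" "omega \<in> U"
    and closed: "\<And>u n v. u \<in> U \<Longrightarrow> v \<in> U \<Longrightarrow> Y u n v \<in> U"
  shows "voa smul U Y vac omega"
proof -
  have V: "u \<in> V" if "u \<in> U" for u using that U by blast
  have ws: "weight_space smul U Y omega c \<subseteq> weight_space smul V Y omega c" for c
    using U(2) unfolding weight_space_eq eigenspace_on_def by blast
  show ?thesis
  proof
    show "subspace U" "vac \<in> U" "omega \<in> U" by fact+
    show "vertex_operator_map smul U smul U Y"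
      using closed Y_truncation V Y_add Y_smul Y_add_left Y_smul_left
      unfolding vertex_operator_map_def linear_on_carrier_def by simp
    show "Y vac n v = (if n = -1 then v else 0)" if "v \<in> U" for v n
      using vacuum V that by blast
    show "Y u n vac = 0" if "u \<in> U" "n \<ge> 0" for u n using creation_nonneg V that by blast
    show "Y u (-1) vac = u" if "u \<in> U" for u using creation V that by blast
    show "jacobi_identity U Y smul U Y"
      using jacobi V unfolding jacobi_identity_def by simp
    show "\<exists>c. \<forall>m n. \<forall>v\<in>U.
          vir_mode Y omega m (vir_mode Y omega n v) - vir_mode Y omega n (vir_mode Y omega m v)
          = smul (of_int (m - n)) (vir_mode Y omega (m + n) v)
            + smul (if m + n = 0 then of_int (m ^ 3 - m) / 12 * c else 0) v"
      using virasoro V by meson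
    show "Y (vir_mode Y omega (-1) u) n v = smul (- of_int n) (Y u (n - 1) v)"
      if "u \<in> U" "v \<in> U" for u v n using derivative V that by blast
    show "internal_direct_sum smul UNIV (\<lambda>n::int. weight_space smul U Y omega (of_int n)) U"
      unfolding weight_space_eq
    proof (intro internal_direct_sum_eigenspacesI invariant_subspace_subset_span_eigenspaces[OF
          subspace_V Y_linear[OF omega_in] _ V_subset_span_weight_spaces] U)
      show "linear_on_carrier smul U smul (Y omega 1)"
        using Y_linear[OF omega_in] V unfolding linear_on_carrier_def by blast
      show "Y omega 1 x \<in> U" if "x \<in> U" for x using closed U(4) that by blast
    qed (auto simp: inj_on_def)
    show "finite_dim smul (weight_space smul U Y omega (of_int n))" for n
      using weight_finite_dim[of n] ws unfolding finite_dim_def by blast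
    obtain N where N: "\<forall>n<N. weight_space smul V Y omega (of_int n) = {0}"
      using weight_bounded_below by blast
    have "0 \<in> weight_space smul U Y omega c" for c
      using subspace_0[OF U(1)] Y_zero[OF omega_in] by (simp add: weight_space_eq eigenspace_on_def)
    then show "\<exists>N. \<forall>n<N. weight_space smul U Y omega (of_int n) = {0}"
      using N ws by (intro exI[of _ N]) blast
  qed
qed

lemma weight_integral:
  assumes "x \<in> weight_space smul V Y omega c" "x \<noteq> 0"
  shows "c \<in> \<int>"
proof -
  have "x \<in> V" using assms by (auto simp: weight_space_eq eigenspace_on_def)
  then have "c \<in> of_int ` (UNIV :: int set)"
    using assms V_subset_span_weight_spaces unfolding weight_space_eq
    by (intro eigenvalue_in_spectrum[OF subspace_V Y_linear[OF omega_in]]) (auto simp: inj_on_def)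
  then show ?thesis by auto
qed

text \<open>
  A module is graded by complex weights, while \<open>V\<close> is graded by integers; the weight spaces
  at the other complex numbers vanish by \<open>weight_integral\<close>.
\<close>

lemma stable_subspace_module:
  assumes U: "voa smul U Y vac omega" "U \<subseteq> V"
    and W: "subspace W" "W \<subseteq> V"
    and closed: "\<And>u n w. u \<in> U \<Longrightarrow> w \<in> W \<Longrightarrow> Y u n w \<in> W"
  shows "voa_module smul U Y vac omega smul W Y"
proof -
  interpret U: voa smul U Y vac omega by fact
  have UV: "u \<in> V" if "u \<in> U" for u using that U by blast
  have WV: "w \<in> V" if "w \<in> W" for w using that W by blast
  have ws: "weight_space smul W Y omega c \<subseteq> weight_space smul V Y omega c" for c
    using W(2) unfolding weight_space_eq eigenspace_on_def by blast
  have zero: "0 \<in> weight_space smul W Y omega c" for c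
    using subspace_0[OF W(1)] Y_zero[OF omega_in] by (simp add: weight_space_eq eigenspace_on_def)
  have nonint: "weight_space smul W Y omega c = {0}" if "c \<notin> \<int>" for c
    using weight_integral that ws zero by blast
  show ?thesis
  proof
    show "subspace W" by fact
    show "vertex_operator_map smul U smul W Y"
      using closed Y_truncation UV WV Y_add Y_smul Y_add_left Y_smul_left
      unfolding vertex_operator_map_def linear_on_carrier_def by simp
    show "Y vac n w = (if n = -1 then w else 0)" if "w \<in> W" for w n
      using vacuum WV that by blast
    show "jacobi_identity U Y smul W Y"
      using jacobi UV WV unfolding jacobi_identity_def by simp
    show "internal_direct_sum smul UNIV (weight_space smul W Y omega) W"
      unfolding weight_space_eq
    proof (rule internal_direct_sum_eigenspacesI[where ev = "\<lambda>c. c"])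
      show "linear_on_carrier smul W smul (Y omega 1)"
        using Y_linear[OF omega_in] WV unfolding linear_on_carrier_def by blast
      have "W \<subseteq> span (\<Union>n\<in>(UNIV::int set). eigenspace_on smul W (Y omega 1) (of_int n))"
        using W closed U.omega_in
        by (intro invariant_subspace_subset_span_eigenspaces[OF
          subspace_V Y_linear[OF omega_in] _ V_subset_span_weight_spaces]) (auto simp: inj_on_def)
      also have "\<dots> \<subseteq> span (\<Union>c\<in>UNIV. eigenspace_on smul W (Y omega 1) c)"
        by (rule span_mono) blast
      finally show "W \<subseteq> span (\<Union>c\<in>UNIV. eigenspace_on smul W (Y omega 1) c)" .
    qed (use W in auto)
    show "finite_dim smul (weight_space smul W Y omega c)" for c
    proof (cases "c \<in> \<int>")
      case True
      then obtain n where "c = of_int n" by (elim Ints_cases)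
      then obtain B where "finite B" "weight_space smul V Y omega c \<subseteq> span B"
        using weight_finite_dim[of n] unfolding finite_dim_def by auto
      then show ?thesis using ws[of c] unfolding finite_dim_def by blast
    next
      case False
      then show ?thesis unfolding nonint[OF False] finite_dim_def
        by (intro exI[of _ "{}"]) simp
    qed
    show "\<exists>N::int. \<forall>n<N. weight_space smul W Y omega (c + of_int n) = {0}" for c
    proof (cases "c \<in> \<int>")
      case True
      then obtain d where d: "c = of_int d" by (elim Ints_cases)
      obtain N where N: "\<forall>n<N. weight_space smul V Y omega (of_int n) = {0}"
        using weight_bounded_below by blast
      have "weight_space smul W Y omega (c + of_int n) = {0}" if "n < N - d" for n
      proof -
        have "weight_space smul V Y omega (c + of_int n) = {0}"
          using N[rule_format, of "d + n"] that d by simp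
        then show ?thesis using ws[of "c + of_int n"] zero[of "c + of_int n"] by auto
      qed
      then show ?thesis by blast
    next
      case False
      have "c + of_int n \<notin> \<int>" for n
      proof
        assume "c + of_int n \<in> \<int>"
        then have "c + of_int n - of_int n \<in> \<int>" by (intro Ints_diff) auto
        then show False using False by simp
      qed
      then show ?thesis using nonint by blast
    qed
  qed
qed

end

section \<open>Eigenspaces of an automorphism of finite order\<close>

lemma irreducible_voa_module_generated:
  assumes irr: "irreducible_voa_module smul V Y vac omega t W YW" and w: "w \<in> W" "w \<noteq> 0"
  shows "generates_voa_module V t W YW w"
proof -
  interpret voa_module smul V Y vac omega t W YW
    using irr unfolding irreducible_voa_module_def by blast
  let ?H = "voa_submodule V t W YW hull {w}"
  have "voa_submodule V t W YW W"
    using subspace_W module_operators unfolding voa_submodule_def vertex_operator_map_def by blast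
  then have "?H \<subseteq> W" using w by (intro hull_minimal) auto
  moreover have "M.subspace ?H"
    unfolding hull_def by (rule M.subspace_Inter) (auto simp: voa_submodule_def)
  moreover have "YW v n x \<in> ?H" if "v \<in> V" "x \<in> ?H" for v n x
    using that unfolding hull_def voa_submodule_def by blast
  ultimately have "voa_submodule V t W YW ?H" unfolding voa_submodule_def by blast
  moreover have "?H \<noteq> {0}" using w hull_subset[of "{w}" "voa_submodule V t W YW"] by auto
  ultimately show ?thesis
    using irr w unfolding irreducible_voa_module_def generates_voa_module_def by blast
qed

context voa
begin

lemma automorphism_comp:
  assumes f: "voa_automorphism smul V Y vac omega f" and g: "voa_automorphism smul V Y vac omega g"
  shows "voa_automorphism smul V Y vac omega (f \<circ> g)"
proof -
  have "g v \<in> V" if "v \<in> V" for v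
    using g that unfolding voa_automorphism_def by (auto dest: bij_betwE)
  then show ?thesis
    using f g unfolding voa_automorphism_def linear_on_carrier_def by (auto intro: bij_betw_trans)
qed

lemma automorphism_funpow:
  assumes "voa_automorphism smul V Y vac omega g"
  shows "voa_automorphism smul V Y vac omega (g ^^ n)"
proof (induction n)
  case 0
  show ?case by (simp add: voa_automorphism_def linear_on_carrier_def bij_betw_def)
next
  case (Suc n)
  show ?case unfolding funpow.simps by (rule automorphism_comp[OF assms Suc])
qed

end

text \<open>
  The number \<open>N\<close> is any exponent of \<open>g\<close> on \<open>V\<close>, not necessarily its exact order.
\<close>

locale voa_cyclic_automorphism = voa smul V Y vac omega
  for smul :: "complex \<Rightarrow> 'v::ab_group_add \<Rightarrow> 'v"
    and V :: "'v set" and Y :: "'v \<Rightarrow> int \<Rightarrow> 'v \<Rightarrow> 'v" and vac omega :: 'v +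
  fixes g :: "'v \<Rightarrow> 'v" and N :: nat
  assumes automorphism: "voa_automorphism smul V Y vac omega g"
    and order_pos: "N > 0"
    and finite_order: "\<And>v. v \<in> V \<Longrightarrow> (g ^^ N) v = v"
begin

abbreviation E :: "complex \<Rightarrow> 'v set" where "E \<equiv> eigenspace_on smul V g"

text \<open>
  For \<open>c\<^sup>N = 1\<close> this average over the cyclic group is the projection of \<open>V\<close> to \<open>E c\<close> along the other
  eigenspaces.
\<close>

definition proj :: "complex \<Rightarrow> 'v \<Rightarrow> 'v" where
  "proj c x = smul (1 / of_nat N) (\<Sum>j<N. smul (inverse c ^ j) ((g ^^ j) x))"

lemma powers_linear: "linear_on_carrier smul V smul (g ^^ j)"
  and powers_closed: "v \<in> V \<Longrightarrow> (g ^^ j) v \<in> V"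
  and powers_modes: "u \<in> V \<Longrightarrow> v \<in> V \<Longrightarrow> (g ^^ j) (Y u n v) = Y ((g ^^ j) u) n ((g ^^ j) v)"
  using automorphism_funpow[OF automorphism, of j] unfolding voa_automorphism_def
  by (auto dest: bij_betwE)

lemma g_linear: "linear_on_carrier smul V smul g"
  using powers_linear[of 1] by simp

lemma subspace_E: "subspace (E c)"
  using subspace_eigenspace_on[OF subspace_V g_linear] .

lemma E_subset: "E c \<subseteq> V"
  by (auto simp: eigenspace_on_def)

lemma powers_E: "x \<in> E c \<Longrightarrow> (g ^^ j) x = smul (c ^ j) x"
proof (induction j)
  case (Suc j)
  then have "g ((g ^^ j) x) = smul (c ^ j) (g x)"
    using g_linear unfolding linear_on_carrier_def eigenspace_on_def by simp
  then show ?case using Suc by (simp add: eigenspace_on_def mult.commute)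
qed simp

lemma modes_E:
  assumes "u \<in> E c" "v \<in> E d" shows "Y u n v \<in> E (c * d)"
  using assms automorphism Y_closed unfolding voa_automorphism_def eigenspace_on_def
  by (simp add: Y_smul Y_smul_left subspace_scale[OF subspace_V] mult.commute)

lemma proj_linear: "linear_on_carrier smul V smul (proj c)"
  using powers_linear unfolding linear_on_carrier_def proj_def
  by (auto simp: scale_right_distrib sum.distrib scale_sum_right mult.commute mult.left_commute)

lemma proj_in_E:
  assumes c: "c ^ N = 1" and x: "x \<in> V"
  shows "proj c x \<in> E c"
proof -
  have c0: "c \<noteq> 0" using c order_pos by (auto simp: power_0_left)
  let ?a = "\<lambda>j. smul (inverse c ^ j) ((g ^^ j) x)"
  have aV: "?a j \<in> V" for j by (intro subspace_scale[OF subspace_V] powers_closed x)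
  have ga: "g (?a j) = smul c (?a (Suc j))" for j
  proof -
    have "g (?a j) = smul (inverse c ^ j) (g ((g ^^ j) x))"
      using g_linear powers_closed[OF x] unfolding linear_on_carrier_def by blast
    then show ?thesis using c0 by (simp add: mult.assoc[symmetric])
  qed
  have "?a N = ?a 0" using finite_order[OF x] c by (simp add: power_inverse)
  then have "(\<Sum>j<N. ?a (Suc j)) = sum ?a {..<N}"
    using sum.lessThan_Suc_shift[of ?a N] sum.lessThan_Suc[of ?a N] by simp
  moreover have "g (sum ?a {..<N}) = smul c (\<Sum>j<N. ?a (Suc j))"
    using linear_on_carrier_sum[OF subspace_V g_linear, of "{..<N}" ?a] aV
    by (simp only: ga scale_sum_right)
  moreover have sV: "sum ?a {..<N} \<in> V" by (rule subspace_sum[OF subspace_V aV])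
  ultimately have "sum ?a {..<N} \<in> E c" by (simp add: eigenspace_on_def)
  then show ?thesis unfolding proj_def by (rule subspace_scale[OF subspace_E])
qed

text \<open>
  Since \<open>g\<^sup>j u = c\<^sup>j u\<close>, the character values \<open>c\<^sup>-\<^sup>j\<close> of the average cancel, and what is left is the
  average of \<open>v\<close> over the group.
\<close>

lemma proj_mode:
  assumes c: "c \<noteq> 0" and v: "v \<in> V" and u: "u \<in> E c"
  shows "proj c (Y v n u) = Y (proj 1 v) n u"
proof -
  have uV: "u \<in> V" using u E_subset by blast
  have "smul (inverse c ^ j) ((g ^^ j) (Y v n u)) = Y ((g ^^ j) v) n u" for j
    using c powers_modes[OF v uV] powers_E[OF u] Y_smul[OF powers_closed[OF v] uV]
    by (simp add: power_mult_distrib[symmetric])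
  moreover have "(\<Sum>j<N. (g ^^ j) v) \<in> V"
    by (intro subspace_sum[OF subspace_V] powers_closed v)
  ultimately show ?thesis
    using linear_on_carrier_sum[OF subspace_V Y_linear_left[OF uV], of "{..<N}" "\<lambda>j. (g ^^ j) v"]
      powers_closed[OF v] Y_smul_left uV
    unfolding proj_def by simp
qed

lemma proj_eq_self:
  assumes "c \<noteq> 0" "x \<in> E c" shows "proj c x = x"
  using assms order_pos unfolding proj_def
  by (simp add: powers_E power_mult_distrib[symmetric] sum_constant_scale)

text \<open>
  By orthogonality of the characters of the cyclic group, the projections to the eigenspaces add
  up to the identity.
\<close>

lemma eigenspaces_direct_sum:
  assumes root: "\<zeta> ^ N = 1" and primitive: "\<And>j. 0 < j \<Longrightarrow> j < N \<Longrightarrow> \<zeta> ^ j \<noteq> 1"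
  shows "internal_direct_sum smul {..<N} (\<lambda>i. E (\<zeta> ^ i)) V"
proof (rule internal_direct_sum_eigenspacesI[OF subspace_V g_linear])
  have z0: "\<zeta> \<noteq> 0" using root order_pos by (auto simp: power_0_left)
  have ne: "\<zeta> ^ i \<noteq> \<zeta> ^ j" if "i < j" "j < N" for i j
  proof
    assume "\<zeta> ^ i = \<zeta> ^ j"
    also have "\<dots> = \<zeta> ^ i * \<zeta> ^ (j - i)" using that by (simp add: power_add[symmetric])
    finally show False using z0 primitive[of "j - i"] that by simp
  qed
  show "inj_on (\<lambda>i. \<zeta> ^ i) {..<N}"
    using ne by (intro linorder_inj_onI') auto
  show "V \<subseteq> span (\<Union>i\<in>{..<N}. E (\<zeta> ^ i))"
  proof
    fix x assume x: "x \<in> V"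
    have geom: "(\<Sum>i<N. (inverse \<zeta> ^ j) ^ i) = (if j = 0 then of_nat N else 0)" if "j < N" for j
    proof (cases "j = 0")
      case False
      have "inverse \<zeta> ^ j \<noteq> 1" using primitive[of j] that False by (simp add: power_inverse)
      moreover have "(inverse \<zeta> ^ j) ^ N = 1"
        using root by (simp add: power_inverse power_mult[symmetric] mult.commute[of j])
          (simp add: power_mult)
      ultimately show ?thesis using False by (simp add: geometric_sum)
    qed simp
    have swap: "inverse (\<zeta> ^ i) ^ j = (inverse \<zeta> ^ j) ^ i" for i j
      unfolding power_inverse power_mult[symmetric] mult.commute[of i j] ..
    have "(\<Sum>i<N. proj (\<zeta> ^ i) x)
        = smul (1 / of_nat N) (\<Sum>i<N. \<Sum>j<N. smul ((inverse \<zeta> ^ j) ^ i) ((g ^^ j) x))"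
      unfolding proj_def scale_sum_right[symmetric] swap ..
    also have "\<dots> = smul (1 / of_nat N) (\<Sum>j<N. smul (\<Sum>i<N. (inverse \<zeta> ^ j) ^ i) ((g ^^ j) x))"
      by (subst sum.swap) (simp add: scale_sum_left)
    also have "(\<Sum>j<N. smul (\<Sum>i<N. (inverse \<zeta> ^ j) ^ i) ((g ^^ j) x))
        = (\<Sum>j<N. if j = 0 then smul (of_nat N) x else 0)"
      by (rule sum.cong) (auto simp: geom)
    also have "smul (1 / of_nat N) \<dots> = x" using order_pos by simp
    finally have sum: "(\<Sum>i<N. proj (\<zeta> ^ i) x) = x" .
    have "(\<zeta> ^ i) ^ N = (\<zeta> ^ N) ^ i" for i
      unfolding power_mult[symmetric] mult.commute[of i N] ..
    then have "proj (\<zeta> ^ i) x \<in> E (\<zeta> ^ i)" for i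
      using root x by (intro proj_in_E) simp_all
    then have "(\<Sum>i<N. proj (\<zeta> ^ i) x) \<in> span (\<Union>i\<in>{..<N}. E (\<zeta> ^ i))"
      by (intro span_sum span_base) blast
    then show "x \<in> span (\<Union>i\<in>{..<N}. E (\<zeta> ^ i))" unfolding sum .
  qed
qed

lemma fixed_points_voa: "voa smul (E 1) Y vac omega"
proof (rule subalgebra_voa[OF subspace_E E_subset])
  show "vac \<in> E 1" "omega \<in> E 1"
    using vac_in omega_in automorphism by (auto simp: eigenspace_on_def voa_automorphism_def)
  show "Y u n v \<in> E 1" if "u \<in> E 1" "v \<in> E 1" for u n v using modes_E[OF that] by simp
qed

lemma whole_voa_module: "voa_module smul (E 1) Y vac omega smul V Y"
  using stable_subspace_module[OF fixed_points_voa E_subset subspace_V order_refl] Y_closed E_subset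
  by blast

lemma eigenspace_voa_module: "voa_module smul (E 1) Y vac omega smul (E c) Y"
  using stable_subspace_module[OF fixed_points_voa E_subset subspace_E E_subset] modes_E[of _ 1]
  by simp

text \<open>
  For \<open>u \<noteq> 0\<close> in a submodule \<open>U\<close> of \<open>E c\<close>, the vectors \<open>v\<^sub>n u\<close> span \<open>V\<close>, so their projections span
  \<open>E c\<close>; by \<open>proj_mode\<close> these projections are obtained from \<open>u\<close> by modes of fixed points, and so lie
  in \<open>U\<close>.
\<close>

theorem eigenspace_irreducible:
  assumes irr: "\<And>U. voa_submodule V smul V Y U \<Longrightarrow> U = {0} \<or> U = V"
    and c: "c ^ N = 1" and nonzero: "E c \<noteq> {0}"
  shows "irreducible_voa_module smul (E 1) Y vac omega smul (E c) Y"
  unfolding irreducible_voa_module_def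
proof (intro conjI allI impI)
  show "voa_module smul (E 1) Y vac omega smul (E c) Y" by (rule eigenspace_voa_module)
  show "E c \<noteq> {0}" by fact
  fix U assume U: "voa_submodule (E 1) smul (E c) Y U"
  have c0: "c \<noteq> 0" using c order_pos by (auto simp: power_0_left)
  have Usub: "subspace U" and UE: "U \<subseteq> E c" using U unfolding voa_submodule_def by auto
  show "U = {0} \<or> U = E c"
  proof (cases "U = {0}")
    case False
    then obtain u where u: "u \<in> U" "u \<noteq> 0" using subspace_0[OF Usub] by blast
    have uE: "u \<in> E c" and uV: "u \<in> V" using u(1) UE E_subset by auto
    let ?S = "span {Y v n u | v n. v \<in> V}"
    have "u = Y vac (-1) u" using vacuum[OF uV] by simp
    then have "u \<in> ?S" using vac_in by (intro span_base) blast
    then have S: "?S = V" using irr[OF modes_span_submodule[OF uV]] u(2) by blast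
    have "subspace {x \<in> V. proj c x \<in> U}"
      using subspace_V Usub proj_linear[of c] linear_on_carrier_zero[OF subspace_V proj_linear]
      unfolding linear_on_carrier_def by (auto simp: subspace_def)
    moreover have "Y v n u \<in> {x \<in> V. proj c x \<in> U}" if v: "v \<in> V" for v n
    proof -
      have "proj 1 v \<in> E 1" by (rule proj_in_E) (use v in auto)
      then have "Y (proj 1 v) n u \<in> U" using U u(1) unfolding voa_submodule_def by blast
      then show ?thesis using proj_mode[OF c0 v uE] Y_closed[OF v uV] by simp
    qed
    ultimately have "?S \<subseteq> {x \<in> V. proj c x \<in> U}" by (intro span_minimal) auto
    then have "V \<subseteq> {x \<in> V. proj c x \<in> U}" using S by simp
    then have "E c \<subseteq> U" using proj_eq_self[OF c0] E_subset by fastforce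
    then show ?thesis using UE by blast
  qed simp
qed

lemma fixed_points_simple:
  assumes irr: "\<And>U. voa_submodule V smul V Y U \<Longrightarrow> U = {0} \<or> U = V" and "vac \<noteq> 0"
  shows "simple_voa smul (E 1) Y vac omega"
proof -
  have "vac \<in> E 1" using fixed_points_voa unfolding voa_def voa_axioms_def by blast
  then have ne: "E 1 \<noteq> {0}" using assms(2) by blast
  have "U = {0} \<or> U = E 1" if "voa_ideal smul (E 1) Y U" for U
    using eigenspace_irreducible[OF irr _ ne] that
    unfolding irreducible_voa_module_def voa_ideal_def voa_submodule_def by simp
  then show ?thesis unfolding simple_voa_def using fixed_points_voa ne by blast
qed

end

section \<open>Weights and automorphisms of the affine vertex operator algebra\<close>

lemma sl2_brackets:
  "lie_bracket sl2_e sl2_h = mat (-2) ** sl2_e"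
  "lie_bracket sl2_f sl2_h = mat 2 ** sl2_f"
  "lie_bracket sl2_f sl2_e = mat (-1) ** sl2_h"
  "lie_bracket a a = 0"
  by (simp_all add: lie_bracket_def sl2_h_def sl2_e_def sl2_f_def
        vec_eq_iff forall_2 matrix_matrix_mult_def mat_def sum_2)

lemma sl2_traces:
  "trace (sl2_e ** sl2_f) = 1" "trace (sl2_f ** sl2_e) = 1" "trace (sl2_h ** sl2_h) = 2"
  "trace (sl2_e ** sl2_e) = 0" "trace (sl2_f ** sl2_f) = 0"
  "trace (sl2_e ** sl2_h) = 0" "trace (sl2_h ** sl2_e) = 0"
  "trace (sl2_f ** sl2_h) = 0" "trace (sl2_h ** sl2_f) = 0"
  by (simp_all add: sl2_h_def sl2_e_def sl2_f_def trace_def matrix_matrix_mult_def sum_2)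

lemma lie_bracket_scale: "lie_bracket (mat c ** a) b = mat c ** lie_bracket a b"
  and trace_scale: "trace (mat c ** a ** b) = c * trace (a ** b)"
  by (simp_all add: lie_bracket_def trace_def vec_eq_iff forall_2 matrix_matrix_mult_def mat_def
      sum_2 algebra_simps)

lemma sl2_zero: "lie_bracket 0 b = 0" "trace (0 :: complex^2^2) = 0" "0 \<in> sl2"
  by (simp_all add: lie_bracket_def sl2_def trace_def)

lemma sl2_scale: "a \<in> sl2 \<Longrightarrow> mat c ** a \<in> sl2"
  by (simp add: sl2_def trace_def sum_2 matrix_matrix_mult_def mat_def distrib_left[symmetric])

lemma sl2_bracket_closed: "a \<in> sl2 \<Longrightarrow> b \<in> sl2 \<Longrightarrow> lie_bracket a b \<in> sl2"
  by (simp add: sl2_def lie_bracket_def trace_def sum_2 matrix_matrix_mult_def algebra_simps)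

text \<open>
  Linear statements about elements of \<open>sl\<^sub>2\<close> only need to be checked on the Chevalley basis.
\<close>

lemma sl2_induct [consumes 1, case_names e f h add scale]:
  assumes a: "a \<in> sl2"
    and efh: "P sl2_e" "P sl2_f" "P sl2_h"
    and add: "\<And>a b. a \<in> sl2 \<Longrightarrow> b \<in> sl2 \<Longrightarrow> P a \<Longrightarrow> P b \<Longrightarrow> P (a + b)"
    and scale: "\<And>c a. a \<in> sl2 \<Longrightarrow> P a \<Longrightarrow> P (mat c ** a)"
  shows "P a"
proof -
  have mem_add: "b + d \<in> sl2" if "b \<in> sl2" "d \<in> sl2" for b d :: "complex^2^2"
    using that by (simp add: sl2_def trace_add)
  have "a $ 2 $ 2 = - a $ 1 $ 1" using a by (simp add: sl2_def trace_def sum_2 add_eq_0_iff)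
  then have "a = (mat (a $ 1 $ 2) ** sl2_e + mat (a $ 2 $ 1) ** sl2_f) + mat (a $ 1 $ 1) ** sl2_h"
    by (simp add: sl2_h_def sl2_e_def sl2_f_def vec_eq_iff forall_2 matrix_matrix_mult_def mat_def sum_2)
  moreover have "P \<dots>"
    by (intro add scale efh sl2_scale mem_add chevalley_relations(1-3))
  ultimately show ?thesis by simp
qed

sublocale affine_sl2_module \<subseteq> complex_vector_space smul ..

context affine_sl2_module
begin

lemma act_zero: "a \<in> sl2 \<Longrightarrow> act a n 0 = 0"
  using linear_on_carrier_zero[OF carrier_subspace act_linear] .

lemma act_add: "a \<in> sl2 \<Longrightarrow> v \<in> V \<Longrightarrow> w \<in> V \<Longrightarrow> act a n (v + w) = act a n v + act a n w"
  using act_linear unfolding linear_on_carrier_def by blast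

lemma act_smul: "a \<in> sl2 \<Longrightarrow> v \<in> V \<Longrightarrow> act a n (smul c v) = smul c (act a n v)"
  using act_linear unfolding linear_on_carrier_def by blast

lemma act_add_left: "a \<in> sl2 \<Longrightarrow> b \<in> sl2 \<Longrightarrow> v \<in> V \<Longrightarrow> act (a + b) n v = act a n v + act b n v"
  using act_linear_left unfolding linear_on_carrier_def by blast

lemma act_scale_left: "a \<in> sl2 \<Longrightarrow> v \<in> V \<Longrightarrow> act (mat c ** a) n v = smul c (act a n v)"
  using act_linear_left unfolding linear_on_carrier_def by blast

lemma act_zero_left: "v \<in> V \<Longrightarrow> act 0 n v = 0"
  using act_add_left[of 0 0 v n] sl2_zero(3) by simp

lemma act_uminus: "a \<in> sl2 \<Longrightarrow> v \<in> V \<Longrightarrow> act a n (- v) = - act a n v"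
  using act_smul[of a v n "-1"] by simp

lemma act_exchange:
  assumes "a \<in> sl2" "b \<in> sl2" "v \<in> V"
  shows "act a m (act b n v) = act b n (act a m v) + act (lie_bracket a b) (m + n) v
           + smul (if m + n = 0 then of_int m * trace (a ** b) * k else 0) v"
  using act_commutator[OF assms, of m n] by (simp add: diff_eq_eq add.commute add.left_commute)

end

context irreducible_vacuum_module
begin

text \<open>
  A part of the Poincare--Birkhoff--Witt theorem: let \<open>C\<close> be the smallest subspace that contains
  the vacuum and is stable under all \<open>b(-n)\<close>, \<open>n > 0\<close>. The elements that all annihilation operators
  \<open>a(m)\<close>, \<open>m \<ge> 0\<close>, map into \<open>C\<close> contain the vacuum and are again stable under \<open>b(-n)\<close>, because
  \<open>a(m) b(-n) x\<close> is the sum of \<open>b(-n) a(m) x\<close>, of \<open>[a,b](m-n) x\<close> and of a multiple of \<open>x\<close>. So \<open>C\<close> is a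
  submodule, whence \<open>C = V\<close>.
\<close>
lemma creation_operators_generate:
  assumes T: "subspace T" "T \<subseteq> V" "vac \<in> T"
    and create: "\<And>a n x. a \<in> sl2 \<Longrightarrow> n > 0 \<Longrightarrow> x \<in> T \<Longrightarrow> act a (- n) x \<in> T"
  shows "V \<subseteq> T"
proof -
  define C where "C = \<Inter>{T. subspace T \<and> T \<subseteq> V \<and> vac \<in> T \<and>
      (\<forall>a\<in>sl2. \<forall>n>0. \<forall>x\<in>T. act a (- n) x \<in> T)}"
  have C_minimal: "C \<subseteq> T" if "subspace T" "T \<subseteq> V" "vac \<in> T"
    "\<forall>a\<in>sl2. \<forall>n>0. \<forall>x\<in>T. act a (- n) x \<in> T" for T
    using that unfolding C_def by blast
  have C: "subspace C" "vac \<in> C" unfolding C_def by (auto intro!: subspace_Inter)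
  have C_create: "act a (- n) x \<in> C" if "a \<in> sl2" "n > 0" "x \<in> C" for a n x
    using that unfolding C_def by blast
  have CV: "C \<subseteq> V"
    using carrier_subspace vacuum_in act_closed by (intro C_minimal) auto
  let ?T = "{x \<in> C. \<forall>a\<in>sl2. \<forall>m\<ge>0. act a m x \<in> C}"
  have "C \<subseteq> ?T"
  proof (rule C_minimal)
    show "subspace ?T"
      using C(1) CV unfolding subspace_def by (auto simp: act_zero act_add act_smul subset_iff)
    show "?T \<subseteq> V" using CV by blast
    show "vac \<in> ?T" using C vacuum_annihilated subspace_0 by auto
    show "\<forall>b\<in>sl2. \<forall>n>0. \<forall>x\<in>?T. act b (- n) x \<in> ?T"
    proof (intro ballI allI impI CollectI conjI)
      fix b n x assume b: "b \<in> sl2" and n: "(n::int) > 0" and x: "x \<in> ?T"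
      show "act b (- n) x \<in> C" using b n x C_create by auto
      fix a and m :: int assume a: "a \<in> sl2" and m: "m \<ge> 0"
      \<comment> \<open>Either an annihilation operator, handled by the choice of \<open>x\<close>, or a creation operator.\<close>
      have "act (lie_bracket a b) (m + - n) x \<in> C"
      proof (cases "m - n \<ge> 0")
        case False
        then show ?thesis
          using C_create[of "lie_bracket a b" "n - m" x] sl2_bracket_closed[OF a b] x by simp
      qed (use x sl2_bracket_closed[OF a b] in auto)
      moreover have "act b (- n) (act a m x) \<in> C" using C_create b n x a m by auto
      moreover have "x \<in> V" using x CV by blast
      ultimately show "act a m (act b (- n) x) \<in> C"
        using x C(1) unfolding act_exchange[OF a b \<open>x \<in> V\<close>, of m "- n"]
        by (intro subspace_add subspace_scale) auto
    qed
  qed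
  then have ann: "act a m x \<in> C" if "a \<in> sl2" "m \<ge> 0" "x \<in> C" for a m x using that by blast
  have "act a n x \<in> C" if "a \<in> sl2" "x \<in> C" for a n x
    using ann[OF that(1) _ that(2)] C_create[OF that(1) _ that(2), of "- n"] by (cases "n \<ge> 0") auto
  then have "affine_sl2_submodule smul V act C"
    using C CV unfolding affine_sl2_submodule_def by blast
  then have "affine_sl2_submodule smul V act hull {vac} \<subseteq> C"
    using C(2) by (intro hull_minimal) auto
  moreover have "C \<subseteq> T" using T create by (intro C_minimal) auto
  ultimately show ?thesis using vacuum_generates by blast
qed

lemma act_one_vacuum:
  assumes "a \<in> sl2" "b \<in> sl2"
  shows "act a 1 (act b (-1) vac) = smul (trace (a ** b) * k) vac"
  using act_exchange[OF assms vacuum_in, of 1 "-1"] assms vacuum_annihilated sl2_bracket_closed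
  by (simp add: act_zero)

end

context simple_affine_sl2_voa
begin

lemma generator_in: "a \<in> sl2 \<Longrightarrow> act a n vac \<in> V"
  using act_closed vacuum_in by blast

text \<open>
  Move \<open>a(n)\<close> past \<open>b(-1)c(-1)\<close> and use that it annihilates the vacuum.
\<close>

lemma act_quadratic:
  assumes a: "a \<in> sl2" and b: "b \<in> sl2" and c: "c \<in> sl2" and n: "n \<ge> 0"
  shows "act a n (act b (-1) (act c (-1) vac)) =
    (if n = 0 then act b (-1) (act (lie_bracket a c) (-1) vac)
                   + act (lie_bracket a b) (-1) (act c (-1) vac)
     else if n = 1 then smul (k * trace (a ** c)) (act b (-1) vac)
                   + act (lie_bracket (lie_bracket a b) c) (-1) vac
                   + smul (k * trace (a ** b)) (act c (-1) vac)
     else if n = 2 then smul (k * trace (lie_bracket a b ** c)) vac else 0)"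
proof -
  have single: "act x m (act c (-1) vac) = (if m = 0 then act (lie_bracket x c) (-1) vac
      else if m = 1 then smul (k * trace (x ** c)) vac else 0)" if x: "x \<in> sl2" and m: "m \<ge> 0" for x m
    using act_exchange[OF x c vac_in, of m "-1"] vacuum_annihilated m x c sl2_bracket_closed[OF x c]
    by (auto simp: act_zero mult.commute)
  note ab = sl2_bracket_closed[OF a b]
  show ?thesis
    using act_exchange[OF a b generator_in[OF c], of n "-1" "-1"] n ab
    by (auto simp: single a ab act_zero act_smul b vac_in mult.commute)
qed

text \<open>
  The currents are primary of weight 1. For \<open>n = 0\<close> this is invariance of the Casimir element. For
  \<open>n = 1\<close> the terms with the invariant form contribute \<open>2k a(-1)\<one>\<close> and the double brackets the
  Casimir eigenvalue 4 on the adjoint representation, which together cancel the normalisation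
  \<open>1/(2(k+2))\<close>. For \<open>n = 2\<close> the coefficient pairs \<open>a\<close> with the sum of the brackets of dual basis
  vectors, which is \<open>[e,f] + [f,e] + [h,h]/2 = 0\<close>.
\<close>

lemma act_omega:
  assumes a: "a \<in> sl2" and n: "n \<ge> 0"
  shows "act a n omega = (if n = 1 then act a (-1) vac else 0)"
proof -
  let ?Q = "\<lambda>b c. act b (-1) (act c (-1) vac)"
  let ?C = "?Q sl2_e sl2_f + ?Q sl2_f sl2_e + smul (1 / 2) (?Q sl2_h sl2_h)"
  note mem = chevalley_relations(1-3)
  have Q: "?Q b c \<in> V" if "b \<in> sl2" "c \<in> sl2" for b c
    using that by (intro act_closed generator_in)
  have C: "?C \<in> V" by (intro subspace_add[OF subspace_V] subspace_scale[OF subspace_V] Q mem)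
  have dist: "act a n ?C = act a n (?Q sl2_e sl2_f) + act a n (?Q sl2_f sl2_e)
      + smul (1 / 2) (act a n (?Q sl2_h sl2_h))" if "a \<in> sl2" for a
    using that Q mem by (simp add: act_add act_smul subspace_add[OF subspace_V] subspace_scale[OF subspace_V])
  \<comment> \<open>The coefficient is split into the four terms that the quadratic monomials contribute.\<close>
  have double: "smul (4 + k * 2) x = smul k x + smul k x + (smul 2 x + smul 2 x)" for x
    by (simp add: scale_left_distrib[symmetric] mult_2_right[symmetric])
  note comp = act_quadratic mem chevalley_relations sl2_brackets lie_bracket_scale trace_scale
    sl2_traces sl2_zero sl2_scale act_scale_left act_zero_left act_smul act_uminus act_zero
    generator_in vac_in subspace_scale[OF subspace_V]
  have "act a n ?C = smul (if n = 1 then 2 * (k + 2) else 0) (act a (-1) vac)"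
    using a
  proof (induction a rule: sl2_induct)
    case e
    show ?case unfolding dist[OF mem(2)] using n
      by (auto simp: comp double scale_right_distrib scale_right_diff_distrib ac_simps)
  next
    case f
    show ?case unfolding dist[OF mem(3)] using n
      by (auto simp: comp double scale_right_distrib scale_right_diff_distrib ac_simps)
  next
    case h
    show ?case unfolding dist[OF mem(1)] using n
      by (auto simp: comp double scale_right_distrib scale_right_diff_distrib ac_simps)
  next
    case (add a b)
    then show ?case using C vac_in by (simp add: act_add_left scale_right_distrib)
  next
    case (scale c a)
    then show ?case using C vac_in by (simp add: act_scale_left mult.commute)
  qed
  moreover have "k + 2 \<noteq> 0" using noncritical unfolding eq_neg_iff_add_eq_0 .
  ultimately show ?thesis
    unfolding sugawara using act_smul[OF a C] by (simp del: distrib_left_numeral)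
qed

text \<open>
  Writing \<open>[a(m), L(0)]\<close> as the commutator of the modes of \<open>a(-1)\<one>\<close> and \<open>\<omega>\<close>, in this order, only
  requires the products \<open>a(i)\<omega>\<close> with \<open>i \<ge> 0\<close>, and by \<open>act_omega\<close> just the one with \<open>i = 1\<close> survives.
\<close>

lemma act_weight:
  assumes a: "a \<in> sl2" and v: "v \<in> V"
  shows "Y omega 1 (act a m v) = act a m (Y omega 1 v) - smul (of_int m) (act a m v)"
proof -
  let ?a = "act a (-1) vac"
  have aV: "?a \<in> V" using generator_in a by blast
  have "Y (Y ?a (int i) omega) (m + 1 - int i) v = (if i = 1 then act a m v else 0)" for i
    using vertex_operator_generator[OF a] omega_in v act_omega[OF a, of "int i"]
    by (auto simp: Y_zero_left)
  then have "smul (of_int m gchoose i) (Y (Y ?a (int i) omega) (m + 1 - int i) v)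
      = (if i = 1 then smul (of_int m) (act a m v) else 0)" for i
    by simp
  then have "Y ?a m (Y omega 1 v) - Y omega 1 (Y ?a m v) = smul (of_int m) (act a m v)"
    using commutator_formula[OF aV omega_in v, of m 1] by simp
  then show ?thesis
    using vertex_operator_generator[OF a] v Y_closed[OF omega_in v] by (simp add: algebra_simps)
qed

lemma vacuum_weight: "Y omega 1 vac = 0"
  using creation_nonneg omega_in by simp

lemma generator_weight:
  assumes "a \<in> sl2" shows "act a (-1) vac \<in> weight_space smul V Y omega 1"
  using act_weight[OF assms vac_in, of "-1"] generator_in assms
  by (simp add: weight_space_eq eigenspace_on_def vacuum_weight act_zero)

lemma V_subset_vacuum_plus_positive:
  "V \<subseteq> span (insert vac (\<Union>n\<in>{1::nat..}. weight_space smul V Y omega (of_nat n)))"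
    (is "_ \<subseteq> span (insert vac ?P)")
proof (rule creation_operators_generate)
  have PV: "insert vac ?P \<subseteq> V" using vac_in by (auto simp: weight_space_eq eigenspace_on_def)
  then show sub: "span (insert vac ?P) \<subseteq> V" using subspace_V span_minimal by blast
  show "vac \<in> span (insert vac ?P)" by (intro span_base) simp
  fix a and n :: int and x
  assume a: "a \<in> sl2" and n: "n > 0" and x: "x \<in> span (insert vac ?P)"
  have raise: "act a (- n) y \<in> span (insert vac ?P)"
    if y: "y \<in> weight_space smul V Y omega (of_nat i)" for y i
  proof -
    have yV: "y \<in> V" and "Y omega 1 y = smul (of_nat i) y"
      using y by (auto simp: weight_space_eq eigenspace_on_def)
    then have "Y omega 1 (act a (- n) y) = smul (of_nat (i + nat n)) (act a (- n) y)"
      using act_weight[OF a yV, of "- n"] n a by (simp add: act_smul scale_left_distrib)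
    then have "act a (- n) y \<in> weight_space smul V Y omega (of_nat (i + nat n))"
      using act_closed[OF a yV] by (simp add: weight_space_eq eigenspace_on_def)
    moreover have "i + nat n \<in> {1..}" using n by simp
    ultimately show ?thesis by (intro span_base) blast
  qed
  have vac0: "vac \<in> weight_space smul V Y omega (of_nat 0)"
    using vac_in vacuum_weight by (simp add: weight_space_eq eigenspace_on_def)
  have "subspace {x \<in> V. act a (- n) x \<in> span (insert vac ?P)}"
    using subspace_V a unfolding subspace_def
    by (simp add: act_zero act_add act_smul span_zero span_add span_scale)
  moreover have "insert vac ?P \<subseteq> {x \<in> V. act a (- n) x \<in> span (insert vac ?P)}"
    using PV raise vac0 by blast
  ultimately have "span (insert vac ?P) \<subseteq> {x \<in> V. act a (- n) x \<in> span (insert vac ?P)}"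
    by (intro span_minimal)
  then show "act a (- n) x \<in> span (insert vac ?P)" using x by blast
qed (rule subspace_span)

text \<open>
  The spanning set \<open>V_subset_vacuum_plus_positive\<close> consists of eigenvectors of \<open>L(0)\<close>, so its
  eigenvalues exhaust the weights; a vector of weight 0 has no components of positive weight.
\<close>

lemma weight_cases:
  assumes w: "w \<in> weight_space smul V Y omega d" "w \<noteq> 0"
  shows "(d = 0 \<and> (\<exists>c. w = smul c vac)) \<or> (\<exists>n::nat. n \<ge> 1 \<and> d = of_nat n)"
proof (cases "\<exists>n::nat. n \<ge> 1 \<and> d = of_nat n")
  case False
  let ?E = "eigenspace_on smul V (Y omega 1)"
  let ?P = "\<Union>n\<in>{1::nat..}. ?E (of_nat n)"
  note subE = subspace_eigenspace_on[OF subspace_V Y_linear[OF omega_in]]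
  have wE: "w \<in> ?E d" "w \<in> V" using w by (auto simp: weight_space_eq eigenspace_on_def)
  have vac0: "vac \<in> ?E 0" using vac_in vacuum_weight by (simp add: eigenspace_on_def)
  have inj: "inj_on (of_nat :: nat \<Rightarrow> complex) X" for X :: "nat set" by (simp add: inj_on_def)
  have "d \<in> of_nat ` (UNIV :: nat set)"
  proof (rule eigenvalue_in_spectrum[OF subspace_V Y_linear[OF omega_in] inj _ wE(1) w(2)])
    have "vac \<in> ?E (of_nat 0)" using vac0 by simp
    then have "insert vac ?P \<subseteq> (\<Union>n\<in>(UNIV::nat set). ?E (of_nat n))" by blast
    then show "w \<in> span (\<Union>n\<in>(UNIV::nat set). ?E (of_nat n))"
      using V_subset_vacuum_plus_positive wE(2) span_mono unfolding weight_space_eq by blast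
  qed
  then have d0: "d = 0" using False by (metis One_nat_def Suc_leI imageE neq0_conv of_nat_0)
  obtain c where c: "w - smul c vac \<in> span ?P"
    using V_subset_vacuum_plus_positive wE(2) unfolding weight_space_eq
    by (meson in_mono span_breakdown_eq)
  have "w - smul c vac = 0"
  proof (rule ccontr)
    assume "w - smul c vac \<noteq> 0"
    moreover have "w - smul c vac \<in> ?E 0"
      using wE(1) vac0 d0 subE by (intro subspace_diff subspace_scale) auto
    ultimately have "0 \<in> (of_nat :: nat \<Rightarrow> complex) ` {1..}"
      using c by (intro eigenvalue_in_spectrum[OF subspace_V Y_linear[OF omega_in] inj])
    then show False by auto
  qed
  then show ?thesis using d0 by auto
qed simp

text \<open>
  The operators \<open>a(n)\<close> are modes of \<open>V\<close>, so a submodule over the vertex algebra is one over the affine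
  Lie algebra.
\<close>

lemma irreducible_adjoint:
  assumes "voa_submodule V smul V Y U" shows "U = {0} \<or> U = V"
proof (rule irreducible)
  have "act a n v = Y (act a (-1) vac) n v" if "a \<in> sl2" "v \<in> U" for a n v
    using vertex_operator_generator that assms unfolding voa_submodule_def by (metis subsetD)
  then show "affine_sl2_submodule smul V act U"
    using assms generator_in unfolding voa_submodule_def affine_sl2_submodule_def by simp
qed

text \<open>
  The fixed points contain the vacuum and are stable under all \<open>a(n)\<close>, as these are modes of fixed
  vectors.
\<close>

lemma automorphism_eq_id:
  assumes g: "voa_automorphism smul V Y vac omega g"
    and gen: "\<And>a. a \<in> {sl2_e, sl2_f, sl2_h} \<Longrightarrow> g (act a (-1) vac) = act a (-1) vac"
    and v: "v \<in> V"
  shows "g v = v"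
proof -
  have lin: "linear_on_carrier smul V smul g" using g by (simp add: voa_automorphism_def)
  have fix_gen: "g (act a (-1) vac) = act a (-1) vac" if "a \<in> sl2" for a
    using that
  proof (induction rule: sl2_induct)
    case (add a b)
    then show ?case using lin generator_in unfolding linear_on_carrier_def
      by (simp add: act_add_left vac_in)
  next
    case (scale c a)
    then show ?case using lin generator_in unfolding linear_on_carrier_def
      by (simp add: act_scale_left vac_in)
  qed (use gen in auto)
  have "V \<subseteq> {v \<in> V. g v = v}"
  proof (rule creation_operators_generate)
    show "subspace {v \<in> V. g v = v}"
      using subspace_eigenspace_on[OF subspace_V lin, of 1] by (simp add: eigenspace_on_def)
    show "vac \<in> {v \<in> V. g v = v}" using g vac_in by (simp add: voa_automorphism_def)
    fix a n x assume a: "a \<in> sl2" and x: "x \<in> {v \<in> V. g v = v}"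
    have "g (Y (act a (-1) vac) (- n) x) = Y (g (act a (-1) vac)) (- n) (g x)"
      using g generator_in[OF a] x unfolding voa_automorphism_def by blast
    then show "act a (- n) x \<in> {v \<in> V. g v = v}"
      using a x act_closed fix_gen[OF a] vertex_operator_generator[OF a] by simp
  qed auto
  then show ?thesis using v by blast
qed

end

section \<open>The fixed points of an automorphism of order three\<close>

lemma zeta3_cube: "zeta3 ^ 3 = 1"
  and zeta3_ne: "zeta3 \<noteq> 1" "zeta3\<^sup>2 \<noteq> 1"
  and zeta3_square: "zeta3\<^sup>2 = (-1 - csqrt (-3)) / 2"
proof -
  define s where "s = csqrt (-3)"
  have sq: "s * s = -3" unfolding s_def using power2_csqrt[of "-3"] by (simp add: power2_eq_square)
  have z: "zeta3 = (-1 + s) / 2" by (simp add: zeta3_def s_def)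
  have z2: "zeta3\<^sup>2 = (-1 - s) / 2" using sq by (simp add: z power2_eq_square field_simps)
  then show "zeta3\<^sup>2 = (-1 - csqrt (-3)) / 2" by (simp only: s_def)
  have "zeta3 ^ 3 = zeta3\<^sup>2 * zeta3" by (simp add: power3_eq_cube power2_eq_square)
  also have "\<dots> = 1" unfolding z2 unfolding z using sq by (simp add: field_simps)
  finally show "zeta3 ^ 3 = 1" .
  have "s \<noteq> 3" "s \<noteq> -3" using sq by auto
  then have ne: "(-1 + s) / 2 \<noteq> 1" "(-1 - s) / 2 \<noteq> 1" by (auto simp: field_simps add_eq_0_iff2)
  show "zeta3 \<noteq> 1" using ne(1) unfolding z .
  show "zeta3\<^sup>2 \<noteq> 1" using ne(2) unfolding z2 .
qed

context simple_affine_sl2_voa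
begin

lemma weight_space_subset: "W \<subseteq> V \<Longrightarrow> weight_space smul W Y omega d \<subseteq> weight_space smul V Y omega d"
  by (auto simp: weight_space_eq eigenspace_on_def)

lemma lowest_weight_vacuum:
  assumes "W \<subseteq> V" "vac \<in> W"
  shows "lowest_weight_vector smul W Y omega 0 vac"
proof -
  have "vac \<in> weight_space smul W Y omega 0"
    using assms vacuum_weight by (simp add: weight_space_eq eigenspace_on_def)
  moreover have "d - 0 \<in> \<real>\<^sub>\<ge>\<^sub>0" if "is_weight smul W Y omega d" for d
    using that weight_cases weight_space_subset[OF assms(1)] unfolding is_weight_def by fastforce
  ultimately show ?thesis
    using vacuum_nonzero unfolding lowest_weight_vector_def is_lowest_weight_def is_weight_def by blast
qed

lemma lowest_weight_generator:
  assumes W: "subspace W" "W \<subseteq> V" "vac \<notin> W"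
    and a: "a \<in> sl2" "act a (-1) vac \<in> W" "act a (-1) vac \<noteq> 0"
  shows "lowest_weight_vector smul W Y omega 1 (act a (-1) vac)"
proof -
  have "act a (-1) vac \<in> weight_space smul W Y omega 1"
    using a generator_weight[OF a(1)] by (simp add: weight_space_eq eigenspace_on_def)
  moreover have "d - 1 \<in> \<real>\<^sub>\<ge>\<^sub>0" if "is_weight smul W Y omega d" for d
  proof -
    from that obtain w where w0: "w \<noteq> 0" and wd: "w \<in> weight_space smul W Y omega d"
      unfolding is_weight_def by blast
    have wW: "w \<in> W" using wd by (simp add: weight_space_eq eigenspace_on_def)
    have "w \<noteq> smul c vac" for c
    proof
      assume c: "w = smul c vac"
      then have "smul (inverse c) w = vac" using w0 by auto
      then show False using W(3) subspace_scale[OF W(1) wW, of "inverse c"] by simp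
    qed
    then obtain n :: nat where "n \<ge> 1" "d = of_nat n" using weight_cases[OF subsetD[OF weight_space_subset[OF W(2)] wd] w0] by auto
    then have "d - 1 = of_nat (n - 1)" by (simp add: of_nat_diff)
    then show ?thesis by simp
  qed
  ultimately show ?thesis
    using a(3) unfolding lowest_weight_vector_def is_lowest_weight_def is_weight_def by blast
qed

text \<open>
  Otherwise \<open>a(1)b(-1)\<one>\<close>, a nonzero multiple of the vacuum, would vanish.
\<close>

lemma generator_nonzero:
  assumes "a \<in> sl2" "b \<in> sl2" "trace (a ** b) \<noteq> 0" "k \<noteq> 0"
  shows "act b (-1) vac \<noteq> 0"
proof
  assume "act b (-1) vac = 0"
  then have "smul (trace (a ** b) * k) vac = 0"
    using act_one_vacuum[OF assms(1,2)] act_zero[OF assms(1)] by simp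
  then show False using assms vacuum_nonzero by simp
qed

end

theorem theorem3p1:
  fixes smul :: "complex \<Rightarrow> 'v::ab_group_add \<Rightarrow> 'v"
    and V :: "'v set" and Y :: "'v \<Rightarrow> int \<Rightarrow> 'v \<Rightarrow> 'v" and vac omega :: 'v
    and k :: nat and act :: "complex^2^2 \<Rightarrow> int \<Rightarrow> 'v \<Rightarrow> 'v"
    and \<sigma> :: "'v \<Rightarrow> 'v" and V\<^sub>f\<^sub>i\<^sub>x :: "'v set" and L :: "nat \<Rightarrow> 'v set"
  assumes "k \<ge> 1"
    and "simple_affine_sl2_voa smul V Y vac omega (of_nat k) act"
    and "voa_automorphism smul V Y vac omega \<sigma>"
    and "\<sigma> (act sl2_h (-1) vac) = act sl2_h (-1) vac"
    and "\<sigma> (act sl2_e (-1) vac) = smul ((-1 + csqrt (-3)) / 2) (act sl2_e (-1) vac)"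
    and "\<sigma> (act sl2_f (-1) vac) = smul ((-1 - csqrt (-3)) / 2) (act sl2_f (-1) vac)"
    and "V\<^sub>f\<^sub>i\<^sub>x = fixed_points V {id, \<sigma>, \<sigma> \<circ> \<sigma>}"
    and "\<And>i. L i = eigenspace_on smul V \<sigma> (zeta3 ^ i)"
  shows "voa_module smul V\<^sub>f\<^sub>i\<^sub>x Y vac omega smul V Y
    \<and> internal_direct_sum smul {0, 1, 2} L V
    \<and> L 0 = V\<^sub>f\<^sub>i\<^sub>x
    \<and> simple_voa smul (L 0) Y vac omega
    \<and> irreducible_voa_module smul V\<^sub>f\<^sub>i\<^sub>x Y vac omega smul (L 0) Y
    \<and> generates_voa_module V\<^sub>f\<^sub>i\<^sub>x smul (L 0) Y vac
    \<and> lowest_weight_vector smul (L 0) Y omega 0 vac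
    \<and> irreducible_voa_module smul V\<^sub>f\<^sub>i\<^sub>x Y vac omega smul (L 1) Y
    \<and> generates_voa_module V\<^sub>f\<^sub>i\<^sub>x smul (L 1) Y (act sl2_e (-1) vac)
    \<and> lowest_weight_vector smul (L 1) Y omega 1 (act sl2_e (-1) vac)
    \<and> irreducible_voa_module smul V\<^sub>f\<^sub>i\<^sub>x Y vac omega smul (L 2) Y
    \<and> generates_voa_module V\<^sub>f\<^sub>i\<^sub>x smul (L 2) Y (act sl2_f (-1) vac)
    \<and> lowest_weight_vector smul (L 2) Y omega 1 (act sl2_f (-1) vac)"
proof -
  interpret simple_affine_sl2_voa smul V Y vac omega "of_nat k" act by fact
  note gen = chevalley_relations(1-3)
  have lin: "linear_on_carrier smul V smul \<sigma>"
    using assms(3) unfolding voa_automorphism_def by blast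
  have scale: "\<sigma> (smul c (act a (-1) vac)) = smul c (\<sigma> (act a (-1) vac))" if "a \<in> sl2" for c a
    using lin generator_in[OF that] unfolding linear_on_carrier_def by blast
  have eig: "\<sigma> (act sl2_e (-1) vac) = smul zeta3 (act sl2_e (-1) vac)"
      "\<sigma> (act sl2_f (-1) vac) = smul (zeta3\<^sup>2) (act sl2_f (-1) vac)"
    using assms(5,6) unfolding zeta3_square by (simp_all add: zeta3_def)
  \<comment> \<open>The powers of \<open>\<zeta>\<^sub>3\<close> by which \<open>\<sigma>\<^sup>3\<close> multiplies \<open>e(-1)\<one>\<close> and \<open>f(-1)\<one>\<close>.\<close>
  have z3: "zeta3 * zeta3 * zeta3 = 1" using zeta3_cube by (simp add: power3_eq_cube)
  have z6: "zeta3 ^ 6 = 1" using power_mult[of zeta3 3 2] zeta3_cube by simp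
  have "(\<sigma> ^^ 3) (act a (-1) vac) = act a (-1) vac" if "a \<in> {sl2_e, sl2_f, sl2_h}" for a
    using that z3 z6 eig assms(4)
    by (auto simp: numeral_3_eq_3 scale gen)
  then have order: "(\<sigma> ^^ 3) v = v" if "v \<in> V" for v
    using automorphism_eq_id[OF automorphism_funpow[OF assms(3)]] that by blast
  interpret voa_cyclic_automorphism smul V Y vac omega \<sigma> 3
    using assms(3) order by unfold_locales auto
  have L: "L = (\<lambda>i. E (zeta3 ^ i))" using assms(8) by auto
  have L0: "L 0 = E 1" and L1: "L 1 = E zeta3" and L2: "L 2 = E (zeta3\<^sup>2)" by (simp_all add: L)
  have fixed: "V\<^sub>f\<^sub>i\<^sub>x = E 1"
    using assms(7) by (auto simp: fixed_points_def eigenspace_on_def)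
  have vac0: "vac \<in> E 1" and e1: "act sl2_e (-1) vac \<in> E zeta3"
      and f2: "act sl2_f (-1) vac \<in> E (zeta3\<^sup>2)"
    using vac_in assms(3) generator_in gen eig by (simp_all add: eigenspace_on_def voa_automorphism_def)
  have vac_notin: "vac \<notin> E c" if "c \<noteq> 1" for c
  proof
    assume "vac \<in> E c"
    then have "smul (c - 1) vac = 0" using vac0 by (simp add: eigenspace_on_def scale_left_diff_distrib)
    then show False using that vacuum_nonzero by simp
  qed
  have k: "of_nat k \<noteq> (0::complex)" using assms(1) by simp
  have e_ne: "act sl2_e (-1) vac \<noteq> 0" and f_ne: "act sl2_f (-1) vac \<noteq> 0"
    using generator_nonzero[OF gen(3,2) _ k] generator_nonzero[OF gen(2,3) _ k] by (simp_all add: sl2_traces)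
  have z2_cube: "(zeta3\<^sup>2) ^ 3 = 1" using z6 by simp
  have irr0: "irreducible_voa_module smul (E 1) Y vac omega smul (E 1) Y"
    by (rule eigenspace_irreducible[OF irreducible_adjoint]) (use vac0 vacuum_nonzero in auto)
  have irr1: "irreducible_voa_module smul (E 1) Y vac omega smul (E zeta3) Y"
    by (rule eigenspace_irreducible[OF irreducible_adjoint]) (use e1 e_ne zeta3_cube in auto)
  have irr2: "irreducible_voa_module smul (E 1) Y vac omega smul (E (zeta3\<^sup>2)) Y"
    by (rule eigenspace_irreducible[OF irreducible_adjoint]) (use f2 f_ne z2_cube in auto)
  have "zeta3 ^ j \<noteq> 1" if "0 < j" "j < 3" for j
  proof -
    have "j = 1 \<or> j = 2" using that by linarith
    then show ?thesis using zeta3_ne by auto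
  qed
  then have "internal_direct_sum smul {..<3} L V"
    unfolding L by (rule eigenspaces_direct_sum[OF zeta3_cube])
  moreover have "{..<3} = {0, 1, 2::nat}" by auto
  ultimately have sum: "internal_direct_sum smul {0, 1, 2} L V" by simp
  show ?thesis
    unfolding fixed using sum unfolding L0 L1 L2
    by (intro conjI refl whole_voa_module fixed_points_simple irreducible_adjoint vacuum_nonzero
        irr0 irr1 irr2 irreducible_voa_module_generated[OF irr0 vac0 vacuum_nonzero]
        irreducible_voa_module_generated[OF irr1 e1 e_ne]
        irreducible_voa_module_generated[OF irr2 f2 f_ne]
        lowest_weight_vacuum[OF E_subset vac0]
        lowest_weight_generator[OF subspace_E E_subset vac_notin gen(2) e1 e_ne] zeta3_ne
        lowest_weight_generator[OF subspace_E E_subset vac_notin gen(3) f2 f_ne])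
qed

end
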